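(* There exist constants $c_1,c_2>0$ (depending only on $\phi$ and $d$) such that for all $n\in\mathbb{N}=\{1,2,\dots\}$ $$c_1\,\big(\phi^{-1}(n^{-1})\big)^{d/2}\le p^{\phi}(n,0)\le c_2\,\big(\phi^{-1}(n^{-1})\big)^{d/2}.$$
   Context: Let $d\ge 1$ and let $(S_n)_{n\ge0}$ be the simple symmetric random walk on $\mathbb{Z}^d$ (each step is uniform on $\{\pm e_1,\dots,\pm e_d\}$). Let $\phi$ be a complete Bernstein function without drift, normalized by $\phi(0)=0$, $\phi(1)=1$; i.e. $\phi(\lambda)=\int_{(0,\infty)}(1-e^{-\lambda t})\,\mu(dt)$, where $\mu$ is a measure with $\int_{(0,\infty)}(1\wedge t)\,\mu(dt)<\infty$ having a completely monotone density with respect to Lebesgue measure. Assume the scaling condition: there are constants $c_*,c^*>0$ and $0<\alpha_*\le\alpha^*<1$ with $$c_*\Big(\frac Rr\Big)^{\alpha_*}\le\frac{\phi(R)}{\phi(r)}\le c^*\Big(\frac Rr\Big)^{\alpha^*},\qquad 0<r\le R\le1 .$$ The function $\phi$ is strictly increasing and $\phi^{-1}$ denotes its inverse (well defined on $(0,1]$). Put $a_m^\phi=\frac1{m!}\int_{(0,\infty)}t^me^{-t}\,\mu(dt)$, $m\ge1$; then $\sum_{m\ge1}a_m^\phi=1$. Let $R_1,R_2,\dots$ be i.i.d., independent of $(S_n)$, with $\mathbb{P}(R_1=m)=a_m^\phi$, and $\tau_n=R_1+\cdots+R_n$. The subordinate random walk is $S^\phi_n=S_{\tau_n}$, $n\ge0$.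 $\mathbb{P}^x$ is the law of the walk started at $x$, $p^\phi(n,x,y)=\mathbb{P}^x(S^\phi_n=y)$, and $p^\phi(n,0)=p^\phi(n,x,x)$ (independent of $x$). *)

theory Defs
  imports "HOL-Probability.Probability"
begin

section \<open>Complete Bernstein functions without drift\<close>

definition completely_monotone :: "(real \<Rightarrow> real) \<Rightarrow> bool" where
  "completely_monotone m \<longleftrightarrow>
     (\<forall>k. \<forall>t>0. (deriv ^^ k) m differentiable (at t) \<and> 0 \<le> (-1) ^ k * (deriv ^^ k) m t)"

text \<open>
  A measure on \<open>(0,\<infinity>)\<close> is encoded as a Borel measure on the real line that gives no mass to
  \<open>(-\<infinity>,0]\<close>; the indicator in the density ensures this.
\<close>
definition cm_levy_measure :: "real measure \<Rightarrow> bool" where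
  "cm_levy_measure \<mu> \<longleftrightarrow>
     (\<exists>m. completely_monotone m \<and>
          \<mu> = density lborel (\<lambda>t. ennreal (indicator {0<..} t * m t))) \<and>
     (\<integral>\<^sup>+t\<in>{0<..}. ennreal (min 1 t) \<partial>\<mu>) < \<infinity>"

text \<open>
  A Bernstein function determines its Levy measure uniquely; \<open>\<mu>\<close> is carried along as an explicit
  parameter so that the objects built from it below need no choice operator. Values of \<open>\<phi>\<close> at
  negative arguments are irrelevant and left unspecified.
\<close>
definition complete_bernstein_no_drift :: "(real \<Rightarrow> real) \<Rightarrow> real measure \<Rightarrow> bool" where
  "complete_bernstein_no_drift \<phi> \<mu> \<longleftrightarrow>
     cm_levy_measure \<mu> \<and> (\<forall>s\<ge>0. \<phi> s = (LINT t:{0<..}|\<mu>. 1 - exp (- s * t)))"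

definition scaling_condition :: "(real \<Rightarrow> real) \<Rightarrow> bool" where
  "scaling_condition \<phi> \<longleftrightarrow>
     (\<exists>c_low c_up \<alpha>_low \<alpha>_up. 0 < c_low \<and> 0 < c_up \<and> 0 < \<alpha>_low \<and> \<alpha>_low \<le> \<alpha>_up \<and> \<alpha>_up < 1 \<and>
       (\<forall>r R. 0 < r \<and> r \<le> R \<and> R \<le> 1 \<longrightarrow>
          c_low * (R / r) powr \<alpha>_low \<le> \<phi> R / \<phi> r \<and>
          \<phi> R / \<phi> r \<le> c_up * (R / r) powr \<alpha>_up))"

text \<open>
  Under the standing assumptions \<open>\<phi>\<close> is strictly increasing and continuous on \<open>[0,\<infinity>)\<close> with
  \<open>\<phi> 0 = 0\<close> and \<open>\<phi> 1 = 1\<close>, so this is the genuine inverse on \<open>(0,1]\<close>.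
\<close>
definition bernstein_inv :: "(real \<Rightarrow> real) \<Rightarrow> real \<Rightarrow> real" where
  "bernstein_inv \<phi> = the_inv_into {0<..} \<phi>"


section \<open>The subordinate random walk\<close>

definition srw_step :: "(int ^ 'd) pmf" where
  "srw_step = pmf_of_set (range (\<lambda>i. axis i 1) \<union> range (\<lambda>i. axis i (- 1)))"

definition sub_weight :: "real measure \<Rightarrow> nat \<Rightarrow> real" where
  "sub_weight \<mu> m = 1 / fact m * (LINT t:{0<..}|\<mu>. t ^ m * exp (- t))"

definition sub_step :: "real measure \<Rightarrow> nat pmf" where
  "sub_step \<mu> = embed_pmf (\<lambda>m. if m = 0 then 0 else sub_weight \<mu> m)"

text \<open>
  The canonical probability space: \<open>\<omega> = (\<xi>, R)\<close>, where \<open>\<xi> 0, \<xi> 1, \<dots>\<close> are the i.i.d. increments of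
  the simple random walk and, independently, \<open>R 0, R 1, \<dots>\<close> are the i.i.d. increments of the
  subordinator (indices shifted down by one).
\<close>
definition walk_space :: "real measure \<Rightarrow> ((nat \<Rightarrow> int ^ 'd) \<times> (nat \<Rightarrow> nat)) measure" where
  "walk_space \<mu> =
     (\<Pi>\<^sub>M i\<in>UNIV. measure_pmf srw_step) \<Otimes>\<^sub>M (\<Pi>\<^sub>M i\<in>UNIV. measure_pmf (sub_step \<mu>))"

definition srw :: "int ^ 'd \<Rightarrow> nat \<Rightarrow> (nat \<Rightarrow> int ^ 'd) \<times> (nat \<Rightarrow> nat) \<Rightarrow> int ^ 'd" where
  "srw x n \<omega> = x + (\<Sum>i<n. fst \<omega> i)"

definition subordinator :: "nat \<Rightarrow> (nat \<Rightarrow> int ^ 'd) \<times> (nat \<Rightarrow> nat) \<Rightarrow> nat" where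
  "subordinator n \<omega> = (\<Sum>i<n. snd \<omega> i)"

definition sub_walk :: "int ^ 'd \<Rightarrow> nat \<Rightarrow> (nat \<Rightarrow> int ^ 'd) \<times> (nat \<Rightarrow> nat) \<Rightarrow> int ^ 'd" where
  "sub_walk x n \<omega> = srw x (subordinator n \<omega>) \<omega>"

definition sub_trans_prob :: "real measure \<Rightarrow> nat \<Rightarrow> int ^ 'd \<Rightarrow> int ^ 'd \<Rightarrow> real" where
  "sub_trans_prob \<mu> n x y = \<P>(\<omega> in walk_space \<mu>. sub_walk x n \<omega> = y)"


section \<open>Well-definedness of the subordinator's step distribution\<close>

lemma cm_levy_measure_sets:
  assumes "cm_levy_measure \<mu>"
  shows "sets \<mu> = sets borel" "space \<mu> = UNIV"
  using assms by (auto simp: cm_levy_measure_def)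

lemma sum_exp_weights:
  fixes t :: real
  shows "(\<lambda>m. if m = 0 then 0 else t ^ m * exp (- t) / fact m) sums (1 - exp (- t))"
proof -
  have "(\<lambda>m. t ^ m /\<^sub>R fact m) sums exp t"
    by (rule exp_converges)
  then have "(\<lambda>m. t ^ m /\<^sub>R fact m * exp (- t)) sums (exp t * exp (- t))"
    by (rule sums_mult2)
  then have 1: "(\<lambda>m. t ^ m * exp (- t) / fact m) sums 1"
    by (simp add: exp_minus field_simps)
  have 2: "(\<lambda>m. if m = 0 then exp (- t) else (0::real)) sums exp (- t)"
    using sums_If_finite_set[of "{0}" "\<lambda>_. exp (- t)"] by simp
  show ?thesis
    using sums_diff[OF 1 2] by (rule sums_cong[THEN iffD1, rotated]) simp
qed

lemma pmf_sub_step: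
  assumes bern: "complete_bernstein_no_drift \<phi> \<mu>" and one: "\<phi> 1 = 1"
  shows "pmf (sub_step \<mu>) m = (if m = 0 then 0 else sub_weight \<mu> m)"
proof -
  have levy: "cm_levy_measure \<mu>"
    using bern by (simp add: complete_bernstein_no_drift_def)
  note [measurable_cong] = cm_levy_measure_sets(1)[OF levy]
  define g where "g t = indicator {0<..} t * (1 - exp (- t))" for t :: real
  define h where
    "h k t = indicator {0<..} t * (if k = 0 then 0 else t ^ k * exp (- t) / fact k)"
    for k :: nat and t :: real
  define w where "w k = (if k = 0 then 0 else sub_weight \<mu> k)" for k
  have hm [measurable]: "h k \<in> borel_measurable \<mu>" for k
    unfolding h_def by measurable
  have h_nonneg: "0 \<le> h k t" for k t
    by (auto simp: h_def indicator_def)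
  have h_sums: "(\<lambda>k. h k t) sums g t" for t
    using sums_mult[OF sum_exp_weights[of t], of "indicator {0<..} t"] by (simp add: h_def g_def)
  have g_int: "integral\<^sup>L \<mu> g = 1"
    using bern one by (auto simp: complete_bernstein_no_drift_def set_lebesgue_integral_def g_def[abs_def])
  then have g_integrable: "integrable \<mu> g"
    by (metis not_integrable_integral_eq zero_neq_one)
  have h_le: "h k t \<le> g t" for k t
    using sum_le_suminf[of "\<lambda>k. h k t" "{k}"] h_sums[of t] h_nonneg
    by (auto simp: sums_iff)
  have h_integrable: "integrable \<mu> (h k)" for k
    by (rule Bochner_Integration.integrable_bound[OF g_integrable])
       (use h_le h_nonneg in \<open>auto intro!: AE_I2 order_trans[OF h_le abs_ge_self]\<close>)
  have h_int: "integral\<^sup>L \<mu> (h k) = w k" for k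
    by (cases "k = 0")
       (simp_all add: h_def[abs_def] w_def sub_weight_def set_lebesgue_integral_def mult_ac
         flip: integral_mult_right_zero)
  have w_nonneg: "0 \<le> w k" for k
    using integral_nonneg_AE[of "h k" \<mu>] h_nonneg by (simp add: h_int)
  have "(\<integral>\<^sup>+k. ennreal (w k) \<partial>count_space UNIV) = (\<Sum>k. ennreal (w k))"
    by (rule nn_integral_count_space_nat)
  also have "\<dots> = (\<Sum>k. \<integral>\<^sup>+t. ennreal (h k t) \<partial>\<mu>)"
    by (simp add: nn_integral_eq_integral[OF h_integrable] h_nonneg h_int)
  also have "\<dots> = (\<integral>\<^sup>+t. (\<Sum>k. ennreal (h k t)) \<partial>\<mu>)"
    by (rule nn_integral_suminf[symmetric]) measurable
  also have "\<dots> = (\<integral>\<^sup>+t. ennreal (g t) \<partial>\<mu>)"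
    using h_sums h_nonneg by (simp add: suminf_ennreal2 sums_iff)
  also have "\<dots> = 1"
    using g_int by (subst nn_integral_eq_integral[OF g_integrable]) (auto simp: g_def indicator_def)
  finally have total: "(\<integral>\<^sup>+k. ennreal (w k) \<partial>count_space UNIV) = 1" .
  show ?thesis
    using pmf_embed_pmf[of w m] w_nonneg total by (simp add: sub_step_def w_def[abs_def])
qed

end

theory Submission
  imports Defs
begin

text \<open>
  Write \<open>d\<close> for the dimension, \<open>\<beta> = d/2\<close> and \<open>r\<close> for the solution of \<open>\<phi> r = 1/n\<close>. Conditioning
  on the time change, the return probability is the expectation of \<open>p \<tau>\<close>, where \<open>p k\<close> is the
  probability that the simple random walk is at its starting point after \<open>k\<close> steps and \<open>\<tau>\<close> is the
  sum of \<open>n\<close> independent steps of the subordinator. Two facts then suffice: \<open>p k\<close> is of order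
  \<open>k powr -\<beta>\<close> for even \<open>k\<close> (and never larger), and \<open>\<tau>\<close> lives on the scale \<open>1/r\<close>, is seldom much
  smaller, and is even with probability bounded away from zero.

  The time change is controlled by its generating function: \<open>z ^ \<tau>\<close> has expectation
  \<open>(1 - \<phi> (1 - z)) ^ n\<close> whenever \<open>\<bar>z\<bar> \<le> 1\<close> (\<open>expectation_power_subordinator\<close>). For
  \<open>z = exp (-s)\<close> with \<open>r \<le> s \<le> 1\<close> the lower scaling inequality bounds this by
  \<open>exp (- const * (s/r) powr \<alpha>)\<close>, hence by every negative power of \<open>s/r\<close>, and a dyadic decomposition
  (\<open>negative_moment_le\<close>) turns that into the upper bound \<open>const * r powr \<beta>\<close> for the expectation of
  \<open>(\<tau> + 1) powr -\<beta>\<close>. For \<open>s = r/K\<close> it shows that \<open>\<tau>\<close> exceeds \<open>K/r\<close> with a probability that is small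
  when \<open>K\<close> is large. For \<open>z = -1\<close> it gives the parity of \<open>\<tau>\<close>: since \<open>1 \<le> \<phi> 2 < 2\<close>, the
  probability of an even value is at least \<open>(2 - \<phi> 2)/2\<close> for every \<open>n \<ge> 1\<close>, so small values of \<open>n\<close>
  need no separate treatment.

  For the simple random walk, the upper bound (\<open>srw_return_upper\<close>) is obtained by counting closed
  walks. Once it is known which axis each step uses, the coordinates are independent
  one-dimensional walks, and a walk of length \<open>N\<close> on the integers is closed with probability at most
  \<open>1 / sqrt (N + 1)\<close>. The number of steps along one axis is binomial, and the same negative moment
  lemma applies to it. The lower bound (\<open>srw_return_lower\<close>) is the Cauchy-Schwarz inequality:
  after \<open>m\<close> steps at least half of the mass sits in a ball of radius of order \<open>sqrt m\<close>, so the sum of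
  the squared point masses, which by symmetry is \<open>p (2 * m)\<close>, is at least the inverse of the
  number of lattice points in that ball, up to a constant.
\<close>

section \<open>Sums of independent steps\<close>

text \<open>
  The \<open>k\<close>-fold convolution power of \<open>p\<close>. Working with a PMF instead of a random variable on
  the infinite product space gives access to plain recursion over the number of steps.
\<close>
primrec sum_pmf :: "nat \<Rightarrow> 'a::comm_monoid_add pmf \<Rightarrow> 'a pmf" where
  "sum_pmf 0 p = return_pmf 0"
| "sum_pmf (Suc k) p = bind_pmf p (\<lambda>x. map_pmf ((+) x) (sum_pmf k p))"

text \<open>
  The tower property. It follows from the version for nonnegative functions after adding the
  constant \<open>B\<close>; boundedness matters because alternating functions such as \<open>(-1) ^ k\<close> are needed.
\<close>
lemma expectation_bind_pmf_bounded:
  fixes f :: "'b \<Rightarrow> real"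
  assumes bd: "\<And>y. \<bar>f y\<bar> \<le> B"
  shows "measure_pmf.expectation (bind_pmf p q) f =
    measure_pmf.expectation p (\<lambda>x. measure_pmf.expectation (q x) f)"
proof -
  have int: "integrable (measure_pmf r) f" for r :: "'b pmf"
    by (rule measure_pmf.integrable_const_bound[where B = B]) (use bd in auto)
  have bd_E: "\<bar>measure_pmf.expectation r f\<bar> \<le> B" for r :: "'b pmf"
  proof -
    have "\<bar>measure_pmf.expectation r f\<bar> \<le> measure_pmf.expectation r (\<lambda>y. \<bar>f y\<bar>)"
      by (rule integral_abs_bound)
    also have "\<dots> \<le> measure_pmf.expectation r (\<lambda>_. B)"
      using int by (intro integral_mono integrable_abs) (auto simp: bd)
    finally show ?thesis by simp
  qed
  have int_E: "integrable (measure_pmf p) (\<lambda>x. measure_pmf.expectation (q x) f)"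
    by (rule measure_pmf.integrable_const_bound[where B = B]) (use bd_E in auto)
  have shift: "measure_pmf.expectation r (\<lambda>y. f y + B) = measure_pmf.expectation r f + B"
    for r :: "'b pmf"
    using int by simp
  have nonneg: "0 \<le> f y + B" for y
    using bd[of y] by linarith
  have nonneg_E: "0 \<le> measure_pmf.expectation r f + B" for r :: "'b pmf"
    using bd_E[of r] by linarith
  have nonneg_EE: "0 \<le> measure_pmf.expectation p (\<lambda>x. measure_pmf.expectation (q x) f) + B"
  proof -
    have "0 \<le> measure_pmf.expectation p (\<lambda>x. measure_pmf.expectation (q x) f + B)"
      by (rule Bochner_Integration.integral_nonneg) (rule nonneg_E)
    also have "\<dots> = measure_pmf.expectation p (\<lambda>x. measure_pmf.expectation (q x) f) + B"
      by (subst Bochner_Integration.integral_add[OF int_E]) simp_all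
    finally show ?thesis .
  qed
  have nn: "(\<integral>\<^sup>+y. ennreal (f y + B) \<partial>measure_pmf r) = ennreal (measure_pmf.expectation r f + B)"
    for r :: "'b pmf"
    using int nonneg by (subst nn_integral_eq_integral) (auto simp: shift)
  have "ennreal (measure_pmf.expectation (bind_pmf p q) f + B) =
      (\<integral>\<^sup>+x. ennreal (measure_pmf.expectation (q x) f + B) \<partial>measure_pmf p)"
    unfolding nn[symmetric] by simp
  also have "\<dots> = ennreal (measure_pmf.expectation p (\<lambda>x. measure_pmf.expectation (q x) f) + B)"
    using int_E nonneg_E by (subst nn_integral_eq_integral) auto
  finally show ?thesis
    using nonneg_E[of "bind_pmf p q"] nonneg_EE by (subst (asm) ennreal_inj) auto
qed

lemma measurable_partial_sum [measurable]:
  fixes p :: "'a::{comm_monoid_add, countable} pmf"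
  shows "(\<lambda>\<omega>. \<Sum>i<k. \<omega> i) \<in> measurable (\<Pi>\<^sub>M i\<in>(UNIV::nat set). measure_pmf p) (count_space UNIV)"
proof (induction k)
  case (Suc k)
  have "(\<lambda>\<omega>. \<omega> k) \<in> measurable (\<Pi>\<^sub>M i\<in>(UNIV::nat set). measure_pmf p) (count_space UNIV)"
    by measurable
  with Suc have "(\<lambda>\<omega>. (\<lambda>(x, y). x + y) (\<Sum>i<k. \<omega> i, \<omega> k))
      \<in> measurable (\<Pi>\<^sub>M i\<in>(UNIV::nat set). measure_pmf p) (count_space UNIV)"
    by (intro measurable_compose[OF measurable_Pair, of _ _ "count_space UNIV" _ "count_space UNIV"])
       (simp_all add: pair_measure_countable)
  then show ?case by simp
qed simp

text \<open>
  Both sides satisfy the same recursion: prepending an independent coordinate to an i.i.d. sequence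
  gives an i.i.d. sequence again, so the first summand can be split off.
\<close>
lemma distr_partial_sum:
  fixes p :: "'a::{comm_monoid_add, countable} pmf"
  shows "distr (\<Pi>\<^sub>M i\<in>(UNIV::nat set). measure_pmf p) (count_space UNIV) (\<lambda>\<omega>. \<Sum>i<k. \<omega> i) = measure_pmf (sum_pmf k p)"
proof (induction k)
  case 0
  interpret product_prob_space "\<lambda>_::nat. measure_pmf p" UNIV ..
  show ?case
    by (simp add: distr_const return_pmf.rep_eq)
next
  case (Suc k)
  interpret sequence_space "measure_pmf p" ..
  have cons: "(\<lambda>(s, \<omega>). case_nat s \<omega>) \<in> measurable (measure_pmf p \<Otimes>\<^sub>M S) S"
    by measurable
  have sum_meas: "(\<lambda>\<omega>. indicator A (\<Sum>i<Suc k. \<omega> i) :: ennreal) \<in> borel_measurable S" for A :: "'a set"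
    by (rule measurable_compose[OF measurable_partial_sum]) simp
  show ?case
  proof (rule measure_eqI)
    fix A :: "'a set"
    have "emeasure (distr S (count_space UNIV) (\<lambda>\<omega>. \<Sum>i<Suc k. \<omega> i)) A
      = (\<integral>\<^sup>+\<omega>. indicator A (\<Sum>i<Suc k. \<omega> i) \<partial>S)"
      by (subst nn_integral_indicator[symmetric], simp, subst nn_integral_distr) simp_all
    also have "\<dots> = (\<integral>\<^sup>+z. indicator A (\<Sum>i<Suc k. (case z of (s, \<omega>) \<Rightarrow> case_nat s \<omega>) i) \<partial>(measure_pmf p \<Otimes>\<^sub>M S))"
      by (subst PiM_iter[symmetric], rule nn_integral_distr[OF cons])
         (simp only: measurable_distr_eq1 sum_meas)
    also have "\<dots> = (\<integral>\<^sup>+s. \<integral>\<^sup>+\<omega>. indicator A (\<Sum>i<Suc k. case_nat s \<omega> i) \<partial>S \<partial>measure_pmf p)"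
      by (subst nn_integral_fst[symmetric, OF measurable_compose[OF cons sum_meas]])
         (simp only: prod.case)
    also have "\<dots> = (\<integral>\<^sup>+s. \<integral>\<^sup>+\<omega>. indicator A (s + (\<Sum>i<k. \<omega> i)) \<partial>S \<partial>measure_pmf p)"
      by (simp add: sum.lessThan_Suc_shift del: sum.lessThan_Suc)
    also have "\<dots> = (\<integral>\<^sup>+s. \<integral>\<^sup>+x. indicator A (s + x) \<partial>distr S (count_space UNIV) (\<lambda>\<omega>. \<Sum>i<k. \<omega> i) \<partial>measure_pmf p)"
      by (subst nn_integral_distr) simp_all
    also have "\<dots> = (\<integral>\<^sup>+s. \<integral>\<^sup>+x. indicator A (s + x) \<partial>measure_pmf (sum_pmf k p) \<partial>measure_pmf p)"
      by (simp only: Suc.IH)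
    also have "\<dots> = emeasure (measure_pmf (sum_pmf (Suc k) p)) A"
      by (subst nn_integral_indicator[symmetric]) simp_all
    finally show "emeasure (distr S (count_space UNIV) (\<lambda>\<omega>. \<Sum>i<Suc k. \<omega> i)) A = \<dots>" .
  qed simp
qed

lemma sum_pmf_add: "sum_pmf (m + n) p = bind_pmf (sum_pmf m p) (\<lambda>x. map_pmf ((+) x) (sum_pmf n p))"
proof (induction m)
  case 0
  have "(+) 0 = (\<lambda>x::'a. x)"
    by (simp add: fun_eq_iff)
  then show ?case
    by (simp add: bind_return_pmf)
next
  case (Suc m)
  have "(+) (x + y) = (\<lambda>z. x + (y + z))" for x y :: 'a
    by (simp add: fun_eq_iff add.assoc)
  then show ?case
    by (simp add: Suc bind_assoc_pmf bind_map_pmf map_bind_pmf map_pmf_comp)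
qed

text \<open>
  This form exhibits a walk as a tuple of steps, which is what path counting needs.
\<close>
lemma sum_pmf_conv_Pi_pmf:
  "sum_pmf k p = map_pmf (\<lambda>f. \<Sum>i<k. f i) (Pi_pmf {..<k} 0 (\<lambda>_. p))"
proof (induction k)
  case (Suc k)
  have "map_pmf (\<lambda>f. \<Sum>i<Suc k. f i) (Pi_pmf {..<Suc k} 0 (\<lambda>_. p)) =
      bind_pmf p (\<lambda>y. map_pmf (\<lambda>f. y + (\<Sum>i<k. f i)) (Pi_pmf {..<k} 0 (\<lambda>_. p)))"
    by (simp add: lessThan_Suc Pi_pmf_insert pair_pmf_def map_pmf_def bind_assoc_pmf bind_return_pmf)
  then show ?case by (simp add: Suc.IH map_pmf_comp)
qed simp

lemma expectation_power_sum_pmf: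
  fixes p :: "nat pmf" and z :: real
  assumes "\<bar>z\<bar> \<le> 1"
  shows "measure_pmf.expectation (sum_pmf k p) (\<lambda>x. z ^ x) = measure_pmf.expectation p (\<lambda>x. z ^ x) ^ k"
proof (induction k)
  case (Suc k)
  have "\<bar>z ^ x\<bar> \<le> 1" for x
    using assms by (simp add: power_abs power_le_one)
  then show ?case
    by (simp add: expectation_bind_pmf_bounded[of _ 1] power_add Suc.IH)
qed simp

text \<open>
  Conditioning on the time change: by Fubini, for a fixed sequence of subordinator increments the
  walk is observed at the deterministic time that is their sum.
\<close>
lemma sub_trans_prob_conv_pmf:
  fixes x :: "int ^ 'd"
  shows "sub_trans_prob \<mu> n x x =
    measure_pmf.expectation (sum_pmf n (sub_step \<mu>)) (\<lambda>k. pmf (sum_pmf k (srw_step :: (int ^ 'd) pmf)) 0)"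
proof -
  let ?A = "\<Pi>\<^sub>M i\<in>(UNIV::nat set). measure_pmf (srw_step :: (int ^ 'd) pmf)"
  let ?B = "\<Pi>\<^sub>M i\<in>(UNIV::nat set). measure_pmf (sub_step \<mu>)"
  let ?p = "\<lambda>k. pmf (sum_pmf k (srw_step :: (int ^ 'd) pmf)) 0"
  interpret A: sequence_space "measure_pmf (srw_step :: (int ^ 'd) pmf)" ..
  interpret B: sequence_space "measure_pmf (sub_step \<mu>)" ..
  interpret AB: pair_prob_space ?A ?B ..
  define E where "E = {\<omega> \<in> space (?A \<Otimes>\<^sub>M ?B). (\<Sum>i<(\<Sum>i<n. snd \<omega> i). fst \<omega> i) = 0}"
  have [measurable]: "(\<lambda>\<omega>. \<Sum>i<n. snd \<omega> i) \<in> measurable (?A \<Otimes>\<^sub>M ?B) (count_space UNIV)"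
    by (rule measurable_compose[OF measurable_snd]) measurable
  have [measurable]: "(\<lambda>\<omega>. \<Sum>i<k. fst \<omega> i) \<in> measurable (?A \<Otimes>\<^sub>M ?B) (count_space UNIV)" for k
    by (rule measurable_compose[OF measurable_fst]) measurable
  have "(\<lambda>\<omega>. \<Sum>i<(\<Sum>i<n. snd \<omega> i). fst \<omega> i) \<in> measurable (?A \<Otimes>\<^sub>M ?B) (count_space UNIV)"
    by (rule measurable_compose_countable[where f = "\<lambda>k \<omega>. \<Sum>i<k. fst \<omega> i"]) measurable
  then have E: "E \<in> sets (?A \<Otimes>\<^sub>M ?B)"
    unfolding E_def by measurable
  have slice: "emeasure ?A ((\<lambda>\<xi>. (\<xi>, R)) -` E) = ennreal (?p (\<Sum>i<n. R i))" if "R \<in> space ?B" for R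
  proof -
    have "(\<lambda>\<xi>. (\<xi>, R)) -` E = (\<lambda>\<xi>. \<Sum>i<(\<Sum>i<n. R i). \<xi> i) -` {0} \<inter> space ?A"
      using that by (auto simp: E_def space_pair_measure)
    then have "emeasure ?A ((\<lambda>\<xi>. (\<xi>, R)) -` E) =
        emeasure (distr ?A (count_space UNIV) (\<lambda>\<xi>. \<Sum>i<(\<Sum>i<n. R i). \<xi> i)) {0}"
      by (simp add: emeasure_distr)
    then show ?thesis
      by (simp only: distr_partial_sum) (simp add: emeasure_pmf_single)
  qed
  have "emeasure (?A \<Otimes>\<^sub>M ?B) E = (\<integral>\<^sup>+R. ennreal (?p (\<Sum>i<n. R i)) \<partial>?B)"
    unfolding AB.emeasure_pair_measure_alt2[OF E] by (rule nn_integral_cong) (rule slice)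
  also have "\<dots> = (\<integral>\<^sup>+k. ennreal (?p k) \<partial>distr ?B (count_space UNIV) (\<lambda>R. \<Sum>i<n. R i))"
    by (subst nn_integral_distr) simp_all
  also have "\<dots> = (\<integral>\<^sup>+k. ennreal (?p k) \<partial>measure_pmf (sum_pmf n (sub_step \<mu>)))"
    by (simp only: distr_partial_sum)
  also have "\<dots> = ennreal (measure_pmf.expectation (sum_pmf n (sub_step \<mu>)) ?p)"
    by (intro nn_integral_eq_integral measure_pmf.integrable_const_bound[where B = 1])
       (auto simp: pmf_le_1)
  finally have "measure (?A \<Otimes>\<^sub>M ?B) E = measure_pmf.expectation (sum_pmf n (sub_step \<mu>)) ?p"
    by (simp add: measure_def)
  then show ?thesis
    by (simp add: sub_trans_prob_def walk_space_def sub_walk_def srw_def subordinator_def E_def)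
qed

section \<open>Negative moments from Laplace transforms\<close>

lemma one_minus_exp_ge_half:
  fixes s :: real
  assumes "0 \<le> s" "s \<le> 1"
  shows "s / 2 \<le> 1 - exp (- s)"
proof -
  have "1 + s \<le> exp s" by (rule exp_ge_add_one_self)
  then have "exp (- s) \<le> 1 / (1 + s)"
    using assms by (simp add: exp_minus field_simps)
  also have "\<dots> \<le> 1 - s / 2"
    using assms mult_left_mono[of s 1 s] by (simp add: field_simps)
  finally show ?thesis by simp
qed

text \<open>
  Since \<open>ln u \<le> u - 1\<close>, the logarithm of \<open>x powr \<gamma>\<close> is dominated by \<open>a * x powr \<alpha>\<close> up to an additive
  constant; applying the inequality to \<open>u = a * x powr \<alpha> * \<alpha> / \<gamma>\<close> makes the coefficients match.
\<close>
lemma exp_neg_powr_le: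
  fixes a \<alpha> \<gamma> :: real
  assumes "a > 0" "\<alpha> > 0" "\<gamma> > 0"
  obtains C where "C > 0" "\<And>x. x > 0 \<Longrightarrow> exp (- (a * x powr \<alpha>)) \<le> C * x powr (- \<gamma>)"
proof
  \<comment> \<open>In terms of \<open>y = x powr \<alpha>\<close> the claim compares \<open>y powr g\<close> with \<open>exp (a * y)\<close>.\<close>
  define g where "g = \<gamma> / \<alpha>"
  have g: "g > 0" "g * \<alpha> = \<gamma>" using assms by (auto simp: g_def)
  show "exp (g * ln (g / a)) > 0" by simp
  fix x :: real assume x: "x > 0"
  define y where "y = x powr \<alpha>"
  have y: "y > 0" using x by (simp add: y_def)
  have "ln (a * y / g) \<le> a * y / g - 1"
    using y g assms by (intro ln_le_minus_one) auto
  then have "g * ln (a * y / g) \<le> g * (a * y / g)"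
    using g by (intro mult_left_mono) auto
  then have *: "g * (ln y - ln (g / a)) \<le> a * y"
    using y g assms by (simp add: ln_div ln_mult algebra_simps)
  have "x powr (- \<gamma>) = exp (- (g * ln y))"
    using x g by (simp add: powr_def y_def ln_powr mult.assoc[symmetric])
  then show "exp (- (a * x powr \<alpha>)) \<le> exp (g * ln (g / a)) * x powr (- \<gamma>)"
    using * by (simp add: y_def[symmetric] exp_add[symmetric] right_diff_distrib)
qed

text \<open>
  If \<open>N + 1\<close> lies below \<open>1/r\<close>, choose the largest \<open>j\<close> with \<open>2 ^ j * r * (N + 1) \<le> 1\<close>. By maximality
  \<open>(N + 1) powr -\<beta>\<close> is at most \<open>(2 ^ Suc j * r) powr \<beta>\<close>, and the factor \<open>exp (1 - 2 ^ j * r * N)\<close>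
  is at least one, so the \<open>j\<close>-th term alone dominates. The sum is linear in the exponentials
  \<open>exp (- s) ^ N\<close>, so it can be integrated when only a Laplace transform is known.
\<close>
lemma powr_le_dyadic_sum:
  fixes \<beta> r :: real and N :: nat
  assumes \<beta>: "\<beta> > 0" and r: "0 < r"
  shows "finite {j::nat. 2 ^ j * r \<le> 1}"
    and "real (Suc N) powr (- \<beta>) \<le> r powr \<beta> +
      (\<Sum>j | 2 ^ j * r \<le> 1. (2 ^ Suc j * r) powr \<beta> * (exp 1 * exp (- (2 ^ j * r)) ^ N))"
proof -
  let ?J = "{j::nat. 2 ^ j * r \<le> 1}"
  have "j \<le> nat \<lceil>1 / r\<rceil>" if "2 ^ j * r \<le> 1" for j
  proof -
    have "real j < 2 ^ j" by (rule of_nat_less_two_power)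
    also have "\<dots> \<le> 1 / r" using that r by (simp add: field_simps)
    finally show ?thesis by linarith
  qed
  then show fin: "finite ?J"
    by (intro finite_subset[OF _ finite_atMost[of "nat \<lceil>1 / r\<rceil>"]]) auto
  let ?t = "\<lambda>j. (2 ^ Suc j * r) powr \<beta> * (exp 1 * exp (- (2 ^ j * r)) ^ N)"
  have nonneg: "0 \<le> ?t j" for j by simp
  show "real (Suc N) powr (- \<beta>) \<le> r powr \<beta> + (\<Sum>j\<in>?J. ?t j)"
  proof (cases "r * real (Suc N) \<ge> 1")
    case True
    then have "1 / r \<le> real (Suc N)" using r by (simp only: divide_le_eq mult.commute if_True)
    then have "real (Suc N) powr (- \<beta>) \<le> (1 / r) powr (- \<beta>)"
      using r \<beta> by (intro powr_mono2') auto
    also have "\<dots> = r powr \<beta>" using r by (simp add: powr_minus powr_divide)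
    finally show ?thesis using sum_nonneg[of ?J ?t] nonneg by simp
  next
    case False
    let ?K = "{j::nat. 2 ^ j * r * real (Suc N) \<le> 1}"
    have sub: "?K \<subseteq> ?J"
    proof
      fix j assume "j \<in> ?K"
      then have "2 ^ j * r * real (Suc N) \<le> 1" by simp
      moreover have "2 ^ j * r * 1 \<le> 2 ^ j * r * real (Suc N)"
        using r by (intro mult_left_mono) auto
      ultimately have "2 ^ j * r \<le> 1" by linarith
      then show "j \<in> ?J" by simp
    qed
    have ne: "0 \<in> ?K" using False by simp
    define j where "j = Max ?K"
    have finK: "finite ?K" using fin sub finite_subset by blast
    have j: "j \<in> ?K" unfolding j_def by (rule Max_in[OF finK]) (use ne in blast)
    have "Suc j \<notin> ?K" using Max_ge[OF finK, of "Suc j"] unfolding j_def by auto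
    then have "1 \<le> 2 ^ Suc j * r * real (Suc N)" by simp
    then have "1 / (2 ^ Suc j * r) \<le> real (Suc N)"
      using r by (subst divide_le_eq) (simp only: mult.commute[of "real (Suc N)"] zero_less_mult_iff zero_less_power zero_less_numeral if_True simp_thms)
    then have "real (Suc N) powr (- \<beta>) \<le> (1 / (2 ^ Suc j * r)) powr (- \<beta>)"
      using r \<beta> by (intro powr_mono2') auto
    also have "\<dots> = (2 ^ Suc j * r) powr \<beta> * 1" using r by (simp add: powr_minus powr_divide)
    also have "\<dots> \<le> ?t j"
    proof (rule mult_left_mono)
      have "2 ^ j * r * real N \<le> 2 ^ j * r * real (Suc N)"
        using r by (intro mult_left_mono) auto
      also have "\<dots> \<le> 1" using j by simp
      finally have "0 \<le> 1 - real N * (2 ^ j * r)" by (simp add: algebra_simps)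
      then show "1 \<le> exp 1 * exp (- (2 ^ j * r)) ^ N"
        by (simp add: exp_of_nat_mult[symmetric] exp_add[symmetric])
    qed simp
    also have "\<dots> \<le> (\<Sum>j\<in>?J. ?t j)"
      using j sub fin nonneg by (intro member_le_sum) auto
    finally show ?thesis by (simp add: add_increasing)
  qed
qed

text \<open>
  The exponent \<open>2 * \<beta>\<close> in the hypothesis leaves a factor \<open>2 powr (-\<beta> * j)\<close> for the \<open>j\<close>-th dyadic
  scale after the growth \<open>(2 ^ j) powr \<beta>\<close> is paid for, which makes the sum over all scales a
  convergent geometric series.
\<close>
lemma negative_moment_le:
  fixes p :: "'a pmf" and X :: "'a \<Rightarrow> nat" and \<beta> r C :: real
  assumes \<beta>: "\<beta> > 0" and r: "0 < r" and C: "0 \<le> C"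
    and laplace: "\<And>s. r \<le> s \<Longrightarrow> s \<le> 1 \<Longrightarrow>
      measure_pmf.expectation p (\<lambda>x. exp (- s) ^ X x) \<le> C * (s / r) powr (- (2 * \<beta>))"
  shows "measure_pmf.expectation p (\<lambda>x. real (Suc (X x)) powr (- \<beta>)) \<le>
    (1 + C * exp 1 * 2 powr \<beta> / (1 - 2 powr (- \<beta>))) * r powr \<beta>"
proof -
  let ?E = "measure_pmf.expectation p"
  let ?J = "{j::nat. 2 ^ j * r \<le> 1}"
  have fin: "finite ?J" by (rule powr_le_dyadic_sum(1)[OF \<beta> r])
  have int1: "integrable (measure_pmf p) (\<lambda>x. exp (- s) ^ X x)" if "s \<ge> 0" for s :: real
    using that by (intro measure_pmf.integrable_const_bound[where B = 1]) (auto intro!: power_le_one)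
  have int2: "integrable (measure_pmf p) (\<lambda>x. real (Suc (X x)) powr (- \<beta>))"
  proof (intro measure_pmf.integrable_const_bound[where B = 1] AE_pmfI)
    fix x
    have "real (Suc (X x)) powr (- \<beta>) \<le> 1 powr (- \<beta>)"
      using \<beta> by (intro powr_mono2') auto
    then show "norm (real (Suc (X x)) powr (- \<beta>)) \<le> 1" by simp
  qed simp
  define q where "q = (2::real) powr (- \<beta>)"
  have q: "0 < q" "q < 1" using \<beta> powr_less_mono[of "- \<beta>" 0 "2::real"] by (auto simp: q_def)
  have pq: "(2 ^ j) powr \<beta> * (2 ^ j) powr (- (2 * \<beta>)) = q ^ j" for j
  proof -
    have "((2::real) ^ j) powr \<beta> * (2 ^ j) powr (- (2 * \<beta>)) = (2 powr real j) powr (- \<beta>)"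
      by (simp add: powr_add[symmetric] powr_realpow)
    also have "\<dots> = q ^ j"
      by (simp add: q_def powr_powr powr_realpow[symmetric] mult.commute)
    finally show ?thesis .
  qed
  have "?E (\<lambda>x. real (Suc (X x)) powr (- \<beta>)) \<le>
      ?E (\<lambda>x. r powr \<beta> + (\<Sum>j\<in>?J. (2 ^ Suc j * r) powr \<beta> * (exp 1 * exp (- (2 ^ j * r)) ^ X x)))"
    using r by (intro integral_mono int2 powr_le_dyadic_sum[OF \<beta> r] Bochner_Integration.integrable_add
        Bochner_Integration.integrable_sum integrable_mult_right int1) auto
  also have "\<dots> = r powr \<beta> + (\<Sum>j\<in>?J. (2 ^ Suc j * r) powr \<beta> * (exp 1 * ?E (\<lambda>x. exp (- (2 ^ j * r)) ^ X x)))"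
    using r by (simp add: Bochner_Integration.integral_sum int1)
  also have "(\<Sum>j\<in>?J. (2 ^ Suc j * r) powr \<beta> * (exp 1 * ?E (\<lambda>x. exp (- (2 ^ j * r)) ^ X x))) \<le>
      (\<Sum>j\<in>?J. (2 ^ Suc j * r) powr \<beta> * (exp 1 * (C * (2 ^ j) powr (- (2 * \<beta>)))))"
  proof (intro sum_mono mult_left_mono)
    fix j assume "j \<in> ?J"
    moreover have "1 * r \<le> 2 ^ j * r" using r by (intro mult_right_mono) auto
    ultimately show "?E (\<lambda>x. exp (- (2 ^ j * r)) ^ X x) \<le> C * (2 ^ j) powr (- (2 * \<beta>))"
      using laplace[of "2 ^ j * r"] r by simp
  qed auto
  also have "\<dots> = (\<Sum>j\<in>?J. C * exp 1 * 2 powr \<beta> * r powr \<beta> * q ^ j)"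
    using r by (intro sum.cong refl) (simp add: powr_mult pq[symmetric] mult_ac)
  also have "\<dots> = C * exp 1 * 2 powr \<beta> * r powr \<beta> * (\<Sum>j\<in>?J. q ^ j)"
    by (simp add: sum_distrib_left)
  also have "\<dots> \<le> C * exp 1 * 2 powr \<beta> * r powr \<beta> * (1 / (1 - q))"
    using q C fin sum_le_suminf[of "\<lambda>j. q ^ j" ?J]
    by (intro mult_left_mono) (auto simp: suminf_geometric summable_geometric)
  finally show ?thesis
    by (simp add: q_def algebra_simps)
qed

section \<open>The simple random walk: upper bound\<close>

text \<open>
  Induction with the ratio \<open>2 * (2 * k + 1) / (k + 1)\<close> of consecutive central binomial coefficients;
  the step reduces to \<open>(2 * k + 1) * (2 * k + 3) \<le> 4 * (k + 1)\<^sup>2\<close>.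
\<close>
lemma central_binomial_square_le: "(2 * k choose k)\<^sup>2 * (2 * k + 1) \<le> 16 ^ k"
proof (induction k)
  case (Suc k)
  define c where "c = 2 * k choose k"
  define c' where "c' = 2 * Suc k choose Suc k"
  have a: "c' = 2 * (Suc (2 * k) choose k)"
  proof -
    have "c' = (Suc (2 * k) choose k) + (Suc (2 * k) choose Suc k)"
      by (simp add: c'_def)
    also have "(Suc (2 * k) choose Suc k) = (Suc (2 * k) choose k)"
      using binomial_symmetric[of "Suc k" "Suc (2 * k)"] by simp
    finally show ?thesis by simp
  qed
  have sym: "(Suc (2 * k) choose k) = (Suc (2 * k) choose Suc k)"
    using binomial_symmetric[of "Suc k" "Suc (2 * k)"] by simp
  have "c' * Suc k = 2 * ((Suc (2 * k) choose Suc k) * Suc k)"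
    by (simp only: a sym mult.assoc)
  also have "\<dots> = 2 * (Suc (2 * k) * c)"
    by (simp only: Suc_times_binomial_eq c_def)
  finally have b: "c' * Suc k = 2 * (2 * k + 1) * c"
    by simp
  have "(c'\<^sup>2 * (2 * k + 3)) * (Suc k)\<^sup>2 = (c' * Suc k)\<^sup>2 * (2 * k + 3)"
    by (simp only: power_mult_distrib mult_ac)
  also have "\<dots> = (c\<^sup>2 * (2 * k + 1)) * (4 * ((2 * k + 1) * (2 * k + 3)))"
    unfolding b by (simp only: power_mult_distrib power2_eq_square) algebra
  also have "\<dots> \<le> 16 ^ k * (4 * (4 * (Suc k)\<^sup>2))"
  proof (rule mult_mono)
    show "c\<^sup>2 * (2 * k + 1) \<le> 16 ^ k"
      using Suc.IH by (simp only: c_def)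
    show "4 * ((2 * k + 1) * (2 * k + 3)) \<le> 4 * (4 * (Suc k)\<^sup>2)"
      by (simp add: power2_eq_square algebra_simps)
  qed simp_all
  also have "\<dots> = 16 ^ Suc k * (Suc k)\<^sup>2"
    by (simp only: power_Suc)
  finally have "c'\<^sup>2 * (2 * k + 3) \<le> 16 ^ Suc k"
    by (subst (asm) mult_le_cancel2) simp
  moreover have "2 * Suc k + 1 = 2 * k + 3"
    by simp
  ultimately show ?case
    by (simp only: c'_def)
qed simp

text \<open>
  A closed walk on the integers with time set \<open>A\<close> amounts to the set of its upward steps, which
  must contain exactly half of \<open>A\<close>; this is the one-dimensional return estimate.
\<close>
lemma card_balanced_subsets_le:
  assumes "finite A"
  shows "real (card {B. B \<subseteq> A \<and> 2 * card B = card A}) \<le> 2 ^ card A / sqrt (real (Suc (card A)))"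
proof (cases "even (card A)")
  case True
  then obtain k where k: "card A = 2 * k" by (auto elim: evenE)
  have "card {B. B \<subseteq> A \<and> 2 * card B = card A} = 2 * k choose k"
    using n_subsets[OF assms, of k] by (simp add: k)
  moreover have "real (2 * k choose k) \<le> 4 ^ k / sqrt (real (2 * k + 1))"
  proof -
    have "real ((2 * k choose k)\<^sup>2 * (2 * k + 1)) \<le> real (16 ^ k)"
      using central_binomial_square_le[of k] by (simp only: of_nat_le_iff)
    then have "(real (2 * k choose k))\<^sup>2 * real (2 * k + 1) \<le> real (16 ^ k)"
      by (simp only: of_nat_mult of_nat_power)
    also have "real (16 ^ k) = (4 ^ k)\<^sup>2"
      by (simp add: power_mult[symmetric] power_mult mult.commute[of k] flip: power_mult_distrib)
    finally have "(real (2 * k choose k) * sqrt (real (2 * k + 1)))\<^sup>2 \<le> (4 ^ k)\<^sup>2"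
      by (subst power_mult_distrib) (simp del: of_nat_add of_nat_Suc)
    then have "real (2 * k choose k) * sqrt (real (2 * k + 1)) \<le> 4 ^ k"
      by (rule power2_le_imp_le) simp
    then show ?thesis by (simp add: pos_le_divide_eq)
  qed
  ultimately show ?thesis by (simp add: k power_mult add.commute)
next
  case False
  then have "{B. B \<subseteq> A \<and> 2 * card B = card A} = {}"
    by (metis (mono_tags, lifting) dvd_triv_left empty_Collect_eq)
  then show ?thesis by (simp only: card.empty) simp
qed

abbreviation unit_steps :: "(int ^ 'd) set" where
  "unit_steps \<equiv> range (\<lambda>i. axis i 1) \<union> range (\<lambda>i. axis i (- 1))"

lemma card_unit_steps: "card (unit_steps :: (int ^ 'd) set) = 2 * CARD('d)"
  by (subst card_Un_disjoint) (auto simp: card_image inj_on_def axis_eq_axis)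

text \<open>
  Meaningful only for unit steps, which have a single nonzero coordinate.
\<close>
definition step_axis :: "int ^ 'd \<Rightarrow> 'd" where
  "step_axis v = (THE j. v $ j \<noteq> 0)"

lemma unit_step_nth:
  assumes "v \<in> unit_steps"
  shows "v $ step_axis v = 1 \<or> v $ step_axis v = - 1" "j \<noteq> step_axis v \<Longrightarrow> v $ j = 0"
proof -
  obtain i s where v: "v = axis i s" "s = 1 \<or> s = - 1"
    using assms by auto
  then have "step_axis v = i"
    by (auto simp: step_axis_def axis_def intro!: the_equality split: if_splits)
  then show "v $ step_axis v = 1 \<or> v $ step_axis v = - 1" "j \<noteq> step_axis v \<Longrightarrow> v $ j = 0"
    using v by (auto simp: axis_def)
qed

text \<open>
  A walk is determined by the axis \<open>\<delta> i\<close> of each step together with, for every axis \<open>j\<close>, the set of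
  times at which it moves up along \<open>j\<close>. It is closed only if that set is exactly half of the
  times spent on axis \<open>j\<close>, so for fixed \<open>\<delta>\<close> the count is at most a product of one-dimensional counts.
\<close>
lemma card_closed_walks_le:
  "real (card {f \<in> PiE_dflt {..<k} 0 (\<lambda>_. unit_steps :: (int ^ 'd) set). (\<Sum>i<k. f i) = 0}) \<le>
    2 ^ k * (\<Sum>\<delta> \<in> {..<k} \<rightarrow>\<^sub>E UNIV. \<Prod>j\<in>(UNIV :: 'd set). 1 / sqrt (real (Suc (card {i. i < k \<and> \<delta> i = j}))))"
proof -
  let ?W = "{f \<in> PiE_dflt {..<k} 0 (\<lambda>_. unit_steps :: (int ^ 'd) set). (\<Sum>i<k. f i) = 0}"
  let ?D = "{..<k} \<rightarrow>\<^sub>E (UNIV :: 'd set)"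
  define A where "A \<delta> j = {i. i < k \<and> \<delta> i = j}" for \<delta> :: "nat \<Rightarrow> 'd" and j
  define bal where "bal \<delta> j = {B. B \<subseteq> A \<delta> j \<and> 2 * card B = card (A \<delta> j)}" for \<delta> j
  define dirs where "dirs f = restrict (\<lambda>i. step_axis (f i)) {..<k}" for f :: "nat \<Rightarrow> int ^ 'd"
  define up where "up f = (\<lambda>j. {i. i < k \<and> step_axis (f i) = j \<and> f i $ j = 1})" for f :: "nat \<Rightarrow> int ^ 'd"
  have finA: "finite (A \<delta> j)" for \<delta> j
    by (auto simp: A_def)
  have fin_bal: "finite (bal \<delta> j)" for \<delta> j
    by (auto simp: bal_def finA)
  have A_dirs: "A (dirs f) j = {i. i < k \<and> step_axis (f i) = j}" for f j
    by (auto simp: A_def dirs_def)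
  have inj: "inj_on (\<lambda>f. (dirs f, up f)) ?W"
  proof (rule inj_onI, rule ext)
    fix f g i assume fg: "f \<in> ?W" "g \<in> ?W" and eq: "(dirs f, up f) = (dirs g, up g)"
    show "f i = g i"
    proof (cases "i < k")
      case True
      then have st: "f i \<in> unit_steps" "g i \<in> unit_steps"
        using fg by (auto simp: PiE_dflt_def)
      have ax: "step_axis (f i) = step_axis (g i)"
      proof -
        have "dirs f i = dirs g i" using eq by simp
        then show ?thesis using True by (simp add: dirs_def)
      qed
      have "i \<in> up f (step_axis (f i)) \<longleftrightarrow> i \<in> up g (step_axis (f i))"
        using eq by simp
      then have "f i $ step_axis (f i) = 1 \<longleftrightarrow> g i $ step_axis (f i) = 1"
        using True by (simp add: up_def ax[symmetric])
      then have "f i $ step_axis (f i) = g i $ step_axis (f i)"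
        using unit_step_nth(1)[OF st(1)] unit_step_nth(1)[OF st(2)] unfolding ax by metis
      then have "f i $ j = g i $ j" for j
        using unit_step_nth(2)[OF st(1)] unit_step_nth(2)[OF st(2)] ax
        by (cases "j = step_axis (f i)") simp_all
      then show ?thesis by (simp add: vec_eq_iff)
    next
      case False
      then show ?thesis using fg by (auto simp: PiE_dflt_def)
    qed
  qed
  have up_bal: "up f j \<in> bal (dirs f) j" if f: "f \<in> ?W" for f j
  proof -
    have st: "f i \<in> unit_steps" if "i < k" for i
      using f that by (auto simp: PiE_dflt_def)
    have z: "f i $ j = 0" if "i < k" "step_axis (f i) \<noteq> j" for i
      using unit_step_nth(2)[OF st[OF that(1)]] that(2) by simp
    have sub: "up f j \<subseteq> A (dirs f) j"
      by (auto simp: up_def A_dirs)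
    have "0 = (\<Sum>i<k. f i) $ j"
      using f by simp
    also have "\<dots> = (\<Sum>i<k. f i $ j)"
      by (simp add: sum_component)
    also have "\<dots> = (\<Sum>i\<in>A (dirs f) j. f i $ j)"
      by (rule sum.mono_neutral_right) (auto simp: A_dirs z)
    also have "\<dots> = (\<Sum>i\<in>up f j. f i $ j) + (\<Sum>i\<in>A (dirs f) j - up f j. f i $ j)"
      using sum.subset_diff[OF sub finA, of "\<lambda>i. f i $ j"] by simp
    also have "(\<Sum>i\<in>up f j. f i $ j) = (\<Sum>i\<in>up f j. 1)"
      by (rule sum.cong) (auto simp: up_def)
    also have "(\<Sum>i\<in>A (dirs f) j - up f j. f i $ j) = (\<Sum>i\<in>A (dirs f) j - up f j. - 1)"
      by (rule sum.cong) (use unit_step_nth(1)[OF st] in \<open>auto simp: up_def A_dirs\<close>)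
    finally have "int (card (up f j)) = int (card (A (dirs f) j - up f j))"
      by simp
    also have "\<dots> = int (card (A (dirs f) j)) - int (card (up f j))"
      using sub finA by (simp add: card_Diff_subset finite_subset card_mono of_nat_diff)
    finally have "2 * card (up f j) = card (A (dirs f) j)"
      by linarith
    with sub show ?thesis by (simp add: bal_def)
  qed
  have finD: "finite ?D"
    by (simp add: finite_PiE)
  have "card ?W \<le> card (SIGMA \<delta>:?D. Pi\<^sub>E UNIV (bal \<delta>))"
  proof (rule card_inj_on_le[OF inj])
    show "(\<lambda>f. (dirs f, up f)) ` ?W \<subseteq> (SIGMA \<delta>:?D. Pi\<^sub>E UNIV (bal \<delta>))"
      using up_bal by (auto simp: dirs_def PiE_def)
    show "finite (SIGMA \<delta>:?D. Pi\<^sub>E UNIV (bal \<delta>))"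
      using finD fin_bal by (auto intro!: finite_SigmaI finite_PiE)
  qed
  also have "\<dots> = (\<Sum>\<delta>\<in>?D. \<Prod>j\<in>UNIV. card (bal \<delta> j))"
    using finD fin_bal by (subst card_SigmaI) (auto simp: card_PiE intro!: finite_PiE)
  finally have "real (card ?W) \<le> (\<Sum>\<delta>\<in>?D. \<Prod>j\<in>UNIV. real (card (bal \<delta> j)))"
    by (simp flip: of_nat_le_iff[where 'a = real] add: of_nat_sum of_nat_prod)
  also have "\<dots> \<le> (\<Sum>\<delta>\<in>?D. \<Prod>j\<in>UNIV. 2 ^ card (A \<delta> j) / sqrt (real (Suc (card (A \<delta> j)))))"
    unfolding bal_def by (intro sum_mono prod_mono conjI card_balanced_subsets_le finA) simp
  also have "\<dots> = (\<Sum>\<delta>\<in>?D. 2 ^ k * (\<Prod>j\<in>UNIV. 1 / sqrt (real (Suc (card (A \<delta> j))))))"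
  proof (rule sum.cong[OF refl])
    fix \<delta> assume "\<delta> \<in> ?D"
    have "(\<Sum>j\<in>UNIV. card (A \<delta> j)) = card (\<Union>j. A \<delta> j)"
      by (rule card_UN_disjoint[symmetric]) (auto simp: A_def)
    also have "(\<Union>j. A \<delta> j) = {..<k}"
      by (auto simp: A_def)
    finally have "(\<Prod>j\<in>UNIV. (2::real) ^ card (A \<delta> j)) = 2 ^ k"
      by (simp flip: power_sum)
    then show "(\<Prod>j\<in>UNIV. 2 ^ card (A \<delta> j) / sqrt (real (Suc (card (A \<delta> j))))) =
        2 ^ k * (\<Prod>j\<in>UNIV. 1 / sqrt (real (Suc (card (A \<delta> j)))))"
      by (simp add: prod_dividef)
  qed
  finally show ?thesis
    by (simp add: A_def sum_distrib_left)
qed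

text \<open>
  A crude substitute for the inequality of arithmetic and geometric means: the largest factor
  already dominates. It decouples the (dependent) numbers of steps along different axes.
\<close>
lemma prod_le_sum_power_card:
  fixes y :: "'a \<Rightarrow> real"
  assumes "finite I" "I \<noteq> {}" "\<And>i. i \<in> I \<Longrightarrow> 0 \<le> y i"
  shows "(\<Prod>i\<in>I. y i) \<le> (\<Sum>i\<in>I. y i ^ card I)"
proof -
  have "Max (y ` I) \<in> y ` I"
    using assms by (intro Max_in) auto
  then obtain m where m: "m \<in> I" "y m = Max (y ` I)" by auto
  have "(\<Prod>i\<in>I. y i) \<le> (\<Prod>i\<in>I. y m)"
    using assms m by (intro prod_mono) auto
  also have "\<dots> = y m ^ card I" by simp
  also have "\<dots> \<le> (\<Sum>i\<in>I. y i ^ card I)"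
    using assms m by (intro member_le_sum) auto
  finally show ?thesis .
qed

lemma srw_return_le_expectation:
  "pmf (sum_pmf k (srw_step :: (int ^ 'd) pmf)) 0 \<le>
    (\<Sum>j\<in>UNIV. measure_pmf.expectation (pmf_of_set ({..<k} \<rightarrow>\<^sub>E (UNIV :: 'd set)))
      (\<lambda>\<delta>. real (Suc (card {i. i < k \<and> \<delta> i = j})) powr - (real CARD('d) / 2)))"
proof -
  let ?U = "unit_steps :: (int ^ 'd) set" and ?D = "{..<k} \<rightarrow>\<^sub>E (UNIV :: 'd set)"
  let ?W = "PiE_dflt {..<k} 0 (\<lambda>_. ?U)" and ?d = "CARD('d)"
  let ?N = "\<lambda>\<delta> j. card {i. i < k \<and> \<delta> i = j}"
  have U: "finite ?U" "?U \<noteq> {}" by auto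
  have W: "finite ?W" "?W \<noteq> {}" by auto
  have cardW: "card ?W = (2 * ?d) ^ k"
    by (simp add: card_PiE_dflt card_unit_steps)
  have finD: "finite ?D" "?D \<noteq> {}"
    by (auto simp: finite_PiE PiE_eq_empty_iff)
  have cardD: "card ?D = ?d ^ k"
    by (simp add: card_PiE)
  have "pmf (sum_pmf k (srw_step :: (int ^ 'd) pmf)) 0 =
      measure_pmf.prob (pmf_of_set ?W) {f. (\<Sum>i<k. f i) = 0}"
    unfolding sum_pmf_conv_Pi_pmf srw_step_def pmf_map using U
    by (subst Pi_pmf_of_set) (auto simp: vimage_def)
  also have "\<dots> = real (card {f \<in> ?W. (\<Sum>i<k. f i) = 0}) / real (card ?W)"
    using W by (simp add: measure_pmf_of_set Int_def)
  also have "\<dots> \<le> (2 ^ k * (\<Sum>\<delta>\<in>?D. \<Prod>j\<in>UNIV. 1 / sqrt (real (Suc (?N \<delta> j))))) / real (card ?W)"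
    by (intro divide_right_mono card_closed_walks_le) simp
  also have "\<dots> = (\<Sum>\<delta>\<in>?D. \<Prod>j\<in>UNIV. 1 / sqrt (real (Suc (?N \<delta> j)))) / real (card ?D)"
    by (simp add: cardW cardD power_mult_distrib)
  also have "\<dots> \<le> (\<Sum>\<delta>\<in>?D. \<Sum>j\<in>UNIV. (1 / sqrt (real (Suc (?N \<delta> j)))) ^ ?d) / real (card ?D)"
    by (intro divide_right_mono sum_mono prod_le_sum_power_card) auto
  also have "\<dots> = (\<Sum>\<delta>\<in>?D. \<Sum>j\<in>UNIV. real (Suc (?N \<delta> j)) powr - (real ?d / 2)) / real (card ?D)"
  proof -
    have "(1 / sqrt x) ^ ?d = x powr - (real ?d / 2)" if "x > 0" for x
      using that by (simp add: powr_half_sqrt[symmetric] powr_minus_divide[symmetric] powr_realpow[symmetric] powr_powr)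
    then show ?thesis by simp
  qed
  also have "\<dots> = (\<Sum>j\<in>UNIV. (\<Sum>\<delta>\<in>?D. real (Suc (?N \<delta> j)) powr - (real ?d / 2)) / real (card ?D))"
    by (subst sum.swap) (simp add: sum_divide_distrib)
  finally show ?thesis
    using finD by (simp add: integral_pmf_of_set)
qed

text \<open>
  The number of times a given axis is used is binomial with success probability \<open>1 / d\<close>.
\<close>
lemma axis_count_laplace:
  fixes s :: real and j :: "'d::finite"
  shows "measure_pmf.expectation (pmf_of_set ({..<k} \<rightarrow>\<^sub>E (UNIV :: 'd set)))
      (\<lambda>\<delta>. exp (- s) ^ card {i. i < k \<and> \<delta> i = j}) = (1 - (1 - exp (- s)) / real CARD('d)) ^ k"
proof -
  let ?D = "{..<k} \<rightarrow>\<^sub>E (UNIV :: 'd set)" and ?x = "exp (- s)"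
  have finD: "finite ?D" "?D \<noteq> {}"
    by (auto simp: finite_PiE PiE_eq_empty_iff)
  have pow: "?x ^ card {i. i < k \<and> \<delta> i = j} = (\<Prod>i<k. if \<delta> i = j then ?x else 1)" for \<delta>
  proof -
    have "(\<Prod>i<k. if \<delta> i = j then ?x else 1) = (\<Prod>i\<in>{i. i < k \<and> \<delta> i = j}. ?x)"
      by (rule prod.mono_neutral_cong_right) auto
    then show ?thesis by simp
  qed
  have one: "(\<Sum>y\<in>UNIV. if y = j then ?x else 1) = real CARD('d) * (1 - (1 - ?x) / real CARD('d))"
  proof -
    have "(\<Sum>y\<in>UNIV. if y = j then ?x else 1) = ?x + (\<Sum>y\<in>UNIV - {j}. if y = j then ?x else 1)"
      by (subst sum.remove[of _ j]) auto
    also have "(\<Sum>y\<in>UNIV - {j}. if y = j then ?x else 1) = (\<Sum>y\<in>UNIV - {j}. 1)"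
      by (rule sum.cong) auto
    also have "?x + (\<Sum>y\<in>UNIV - {j}. 1) = ?x + real CARD('d) - 1"
      by (simp add: card_Diff_singleton of_nat_diff Suc_leI)
    also have "\<dots> = real CARD('d) * (1 - (1 - ?x) / real CARD('d))"
      by (simp add: field_simps)
    finally show ?thesis .
  qed
  have "(\<Sum>\<delta>\<in>?D. ?x ^ card {i. i < k \<and> \<delta> i = j}) = (\<Prod>i<k. \<Sum>y\<in>UNIV. if y = j then ?x else 1)"
    unfolding pow by (subst prod_sum_PiE) auto
  also have "\<dots> = real CARD('d) ^ k * (1 - (1 - ?x) / real CARD('d)) ^ k"
    by (simp add: one power_mult_distrib)
  finally show ?thesis
    using finD by (simp add: integral_pmf_of_set card_PiE)
qed

text \<open>
  The bound \<open>negative_moment_le\<close> applies to each axis count at scale \<open>r = 1 / (k + 1)\<close>, because the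
  Laplace transform of a binomial variable decays like \<open>exp (- s * k / (2 * d))\<close>.
\<close>
lemma srw_return_upper:
  "\<exists>C>0. \<forall>k. pmf (sum_pmf k (srw_step :: (int ^ 'd) pmf)) 0 \<le> C * real (Suc k) powr - (real CARD('d) / 2)"
proof -
  define d where "d = real CARD('d)"
  define \<beta> where "\<beta> = d / 2"
  have d: "d \<ge> 1"
    by (simp add: d_def Suc_leI)
  then have \<beta>: "\<beta> > 0" by (simp add: \<beta>_def)
  obtain C0 where C0: "C0 > 0" "\<And>x. x > 0 \<Longrightarrow> exp (- (1 / (2 * d) * x powr 1)) \<le> C0 * x powr - (2 * \<beta>)"
    using exp_neg_powr_le[of "1 / (2 * d)" 1 "2 * \<beta>"] d \<beta> by auto
  define C1 where "C1 = 1 + exp 1 * C0 * exp 1 * 2 powr \<beta> / (1 - 2 powr - \<beta>)"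
  have "2 powr - \<beta> < (1::real)"
    using \<beta> powr_less_mono[of "- \<beta>" 0 "2::real"] by simp
  then have C1: "C1 > 0"
    using C0 unfolding C1_def by (intro add_pos_nonneg) auto
  have bound: "measure_pmf.expectation (pmf_of_set ({..<k} \<rightarrow>\<^sub>E (UNIV :: 'd set)))
      (\<lambda>\<delta>. real (Suc (card {i. i < k \<and> \<delta> i = j})) powr - \<beta>) \<le> C1 * (1 / real (Suc k)) powr \<beta>" for k and j :: 'd
    unfolding C1_def
  proof (rule negative_moment_le[OF \<beta>])
    fix s :: real assume s: "1 / real (Suc k) \<le> s" "s \<le> 1"
    have s0: "0 < s" using s(1) by (rule less_le_trans[rotated]) simp
    have "measure_pmf.expectation (pmf_of_set ({..<k} \<rightarrow>\<^sub>E (UNIV :: 'd set)))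
        (\<lambda>\<delta>. exp (- s) ^ card {i. i < k \<and> \<delta> i = j}) = (1 - (1 - exp (- s)) / d) ^ k"
      unfolding d_def by (rule axis_count_laplace)
    also have "\<dots> \<le> (1 - s / (2 * d)) ^ k"
    proof (rule power_mono)
      have "s / 2 / d \<le> (1 - exp (- s)) / d"
        using one_minus_exp_ge_half[of s] s s0 d by (intro divide_right_mono) auto
      then show "1 - (1 - exp (- s)) / d \<le> 1 - s / (2 * d)" by simp
      have "(1 - exp (- s)) / d \<le> 1 / 1"
        using d by (intro frac_le) auto
      then show "0 \<le> 1 - (1 - exp (- s)) / d" by simp
    qed
    also have "\<dots> \<le> exp (- (s / (2 * d))) ^ k"
    proof (rule power_mono)
      show "1 - s / (2 * d) \<le> exp (- (s / (2 * d)))"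
        using exp_ge_add_one_self[of "- (s / (2 * d))"] by simp
      have "s / (2 * d) \<le> 1 / 1"
        using d s by (intro frac_le) auto
      then show "0 \<le> 1 - s / (2 * d)" by simp
    qed
    \<comment> \<open>Passing from \<open>k\<close> to \<open>k + 1\<close> includes the case \<open>k = 0\<close> and costs a factor of at most \<open>exp 1\<close>.\<close>
    also have "\<dots> = exp (s / (2 * d)) * exp (- (s / (2 * d) * real (Suc k)))"
      by (simp add: exp_of_nat_mult[symmetric] exp_add[symmetric] algebra_simps add_divide_distrib)
    also have "\<dots> \<le> exp 1 * (C0 * (s / (1 / real (Suc k))) powr - (2 * \<beta>))"
    proof (rule mult_mono)
      have "s / (2 * d) \<le> 1 / 1"
        using d s by (intro frac_le) auto
      then show "exp (s / (2 * d)) \<le> exp 1" by simp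
      show "exp (- (s / (2 * d) * real (Suc k))) \<le> C0 * (s / (1 / real (Suc k))) powr - (2 * \<beta>)"
        using C0(2)[of "s * real (Suc k)"] s0 by (simp add: mult_ac)
    qed auto
    finally show "measure_pmf.expectation (pmf_of_set ({..<k} \<rightarrow>\<^sub>E (UNIV :: 'd set)))
        (\<lambda>\<delta>. exp (- s) ^ card {i. i < k \<and> \<delta> i = j}) \<le> exp 1 * C0 * (s / (1 / real (Suc k))) powr - (2 * \<beta>)"
      by (simp only: mult.assoc)
  qed (use C0 in auto)
  show ?thesis
  proof (intro exI[of _ "d * C1"] conjI allI)
    show "d * C1 > 0" using d C1 by simp
    fix k
    have "pmf (sum_pmf k (srw_step :: (int ^ 'd) pmf)) 0 \<le> (\<Sum>j\<in>(UNIV :: 'd set). C1 * (1 / real (Suc k)) powr \<beta>)"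
      using srw_return_le_expectation[where 'd = 'd, of k] sum_mono[of UNIV, OF bound]
      unfolding \<beta>_def d_def by (rule order_trans)
    also have "\<dots> = d * C1 * (1 / real (Suc k)) powr \<beta>"
      by (simp add: d_def)
    also have "(1 / real (Suc k)) powr \<beta> = real (Suc k) powr - (real CARD('d) / 2)"
      by (simp only: \<beta>_def d_def powr_minus_divide powr_divide powr_one_eq_one of_nat_0_le_iff)
    finally show "pmf (sum_pmf k (srw_step :: (int ^ 'd) pmf)) 0 \<le> d * C1 * real (Suc k) powr - (real CARD('d) / 2)" .
  qed
qed

section \<open>The simple random walk: lower bound\<close>

lemma sum_pmf_symmetric:
  fixes p :: "'a::ab_group_add pmf"
  assumes "map_pmf uminus p = p"
  shows "map_pmf uminus (sum_pmf k p) = sum_pmf k p"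
proof (induction k)
  case (Suc k)
  have "map_pmf uminus (sum_pmf (Suc k) p) =
      bind_pmf (map_pmf uminus p) (\<lambda>x. map_pmf ((+) x) (map_pmf uminus (sum_pmf k p)))"
    by (simp add: map_bind_pmf bind_map_pmf map_pmf_comp)
  then show ?case
    by (simp add: Suc.IH assms)
qed simp

text \<open>
  Splitting at half time: the second half has to undo the first, and by symmetry it does so with
  the same probability with which the first half reached its endpoint.
\<close>
lemma sum_pmf_double_return:
  fixes p :: "'a::ab_group_add pmf"
  assumes "map_pmf uminus p = p"
  shows "pmf (sum_pmf (k + k) p) 0 = measure_pmf.expectation (sum_pmf k p) (pmf (sum_pmf k p))"
proof -
  have "pmf (map_pmf ((+) x) (sum_pmf k p)) 0 = pmf (sum_pmf k p) x" for x
  proof -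
    have "pmf (map_pmf ((+) x) (sum_pmf k p)) (x + - x) = pmf (sum_pmf k p) (- x)"
      by (rule pmf_map_inj') (simp add: inj_def)
    also have "\<dots> = pmf (map_pmf uminus (sum_pmf k p)) (- x)"
      by (simp only: sum_pmf_symmetric[OF assms])
    also have "\<dots> = pmf (sum_pmf k p) x"
      by (rule pmf_map_inj') (simp add: inj_def)
    finally show ?thesis by simp
  qed
  then show ?thesis
    by (simp add: sum_pmf_add pmf_bind)
qed

text \<open>
  The Cauchy-Schwarz inequality for the point masses in \<open>B\<close>: mass spread over few points has a
  large collision probability.
\<close>
lemma prob_square_le_card_mult_expectation:
  assumes "finite B"
  shows "(measure_pmf.prob q B)\<^sup>2 \<le> real (card B) * measure_pmf.expectation q (pmf q)"
proof -
  have "(measure_pmf.prob q B)\<^sup>2 = (\<Sum>x\<in>B. 1 * pmf q x)\<^sup>2"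
    using assms by (simp add: measure_measure_pmf_finite)
  also have "\<dots> \<le> (\<Sum>x\<in>B. 1\<^sup>2) * (\<Sum>x\<in>B. (pmf q x)\<^sup>2)"
    by (rule Cauchy_Schwarz_ineq_sum)
  also have "(\<Sum>x\<in>B. (pmf q x)\<^sup>2) = measure_pmf.expectation q (\<lambda>x. pmf q x * indicator B x)"
    using assms by (subst integral_measure_pmf[of B]) (auto simp: power2_eq_square indicator_def)
  also have "(\<Sum>x\<in>B. 1\<^sup>2) * \<dots> \<le> (\<Sum>x\<in>B. 1\<^sup>2) * measure_pmf.expectation q (pmf q)"
    by (intro mult_left_mono integral_mono measure_pmf.integrable_const_bound[where B = 1])
       (auto simp: indicator_def pmf_le_1)
  finally show ?thesis by simp
qed

lemma finite_set_sum_pmf: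
  assumes "finite (set_pmf p)"
  shows "finite (set_pmf (sum_pmf k p))"
  using assms by (induction k) auto

definition sq_length :: "int ^ 'd \<Rightarrow> real" where
  "sq_length v = (\<Sum>j\<in>UNIV. real_of_int (v $ j) ^ 2)"

lemma sq_length_nonneg: "0 \<le> sq_length v"
  by (simp add: sq_length_def sum_nonneg)

text \<open>
  By symmetry a step \<open>a\<close> may be averaged with \<open>- a\<close>, and the parallelogram law then removes the
  cross terms, so that mean squared lengths add up.
\<close>
lemma expectation_sq_length_sum_pmf:
  fixes p :: "(int ^ 'd) pmf"
  assumes fin: "finite (set_pmf p)" and sym: "map_pmf uminus p = p"
  shows "measure_pmf.expectation (sum_pmf k p) sq_length = real k * measure_pmf.expectation p sq_length"
proof (induction k)
  case 0
  show ?case by (simp add: sq_length_def)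
next
  case (Suc k)
  let ?q = "sum_pmf k p"
  define h where "h a = measure_pmf.expectation ?q (\<lambda>x. sq_length (a + x))" for a
  have int_q: "integrable (measure_pmf ?q) f" for f :: "int ^ 'd \<Rightarrow> real"
    by (intro integrable_measure_pmf_finite finite_set_sum_pmf fin)
  have int_p: "integrable (measure_pmf p) f" for f :: "int ^ 'd \<Rightarrow> real"
    by (intro integrable_measure_pmf_finite fin)
  have par: "sq_length (a + x) + sq_length (- a + x) = 2 * sq_length a + 2 * sq_length x" for a x :: "int ^ 'd"
    by (simp add: sq_length_def sum.distrib[symmetric] sum_distrib_left power2_eq_square algebra_simps)
  have h: "h a + h (- a) = 2 * sq_length a + 2 * measure_pmf.expectation ?q sq_length" for a
  proof -
    have "h a + h (- a) = measure_pmf.expectation ?q (\<lambda>x. sq_length (a + x) + sq_length (- a + x))"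
      unfolding h_def by (rule Bochner_Integration.integral_add[symmetric, OF int_q int_q])
    then show ?thesis
      unfolding par by (simp add: int_q)
  qed
  have "measure_pmf.expectation (sum_pmf (Suc k) p) sq_length = measure_pmf.expectation p h"
    unfolding sum_pmf.simps
    by (subst pmf_expectation_bind[OF fin])
       (simp_all add: finite_set_sum_pmf fin integral_measure_pmf[OF fin] h_def)
  moreover have "measure_pmf.expectation p h = measure_pmf.expectation p (\<lambda>a. h (- a))"
    by (subst (1) sym[symmetric]) simp
  ultimately have "2 * measure_pmf.expectation (sum_pmf (Suc k) p) sq_length =
      measure_pmf.expectation p (\<lambda>a. h a + h (- a))"
    by (simp add: int_p)
  also have "\<dots> = 2 * measure_pmf.expectation p sq_length + 2 * measure_pmf.expectation ?q sq_length"
    unfolding h by (simp add: int_p)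
  finally show ?case
    by (simp add: Suc.IH algebra_simps)
qed

lemma card_sq_length_less_le:
  fixes m :: nat
  shows "finite {v :: int ^ 'd. sq_length v < 2 * real (Suc m)}"
    and "real (card {v :: int ^ 'd. sq_length v < 2 * real (Suc m)}) \<le> (4 * sqrt (real (Suc m))) ^ CARD('d)"
proof -
  let ?B = "{v :: int ^ 'd. sq_length v < 2 * real (Suc m)}"
  define L where "L = \<lfloor>sqrt (2 * real (Suc m))\<rfloor>"
  have L0: "L \<ge> 0" by (simp add: L_def)
  have nth: "v $ j \<in> {- L..L}" if "v \<in> ?B" for v j
  proof -
    have "real_of_int (v $ j) ^ 2 \<le> sq_length v"
      unfolding sq_length_def by (rule member_le_sum) auto
    with that have "real_of_int (v $ j) ^ 2 \<le> 2 * real (Suc m)" by simp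
    then have "\<bar>real_of_int (v $ j)\<bar> \<le> sqrt (2 * real (Suc m))"
      by (intro real_le_rsqrt) simp
    then have "\<bar>v $ j\<bar> \<le> L"
      unfolding L_def by (simp add: le_floor_iff)
    then show ?thesis by auto
  qed
  have inj: "inj_on vec_nth ?B"
    by (auto simp: inj_on_def vec_nth_inject)
  have sub: "vec_nth ` ?B \<subseteq> (\<Pi>\<^sub>E j\<in>(UNIV :: 'd set). {- L..L})"
    using nth by (auto simp: PiE_def)
  have fin: "finite (\<Pi>\<^sub>E j\<in>(UNIV :: 'd set). {- L..L})"
    by (intro finite_PiE) auto
  show "finite ?B"
    using finite_imageD[OF finite_subset[OF sub fin] inj] .
  have "card ?B \<le> card (\<Pi>\<^sub>E j\<in>(UNIV :: 'd set). {- L..L})"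
    by (rule card_inj_on_le[OF inj sub fin])
  also have "\<dots> = nat (2 * L + 1) ^ CARD('d)"
    by (simp add: card_PiE)
  finally have "real (card ?B) \<le> real (nat (2 * L + 1)) ^ CARD('d)"
    by (metis of_nat_le_iff of_nat_power)
  also have "\<dots> \<le> (4 * sqrt (real (Suc m))) ^ CARD('d)"
  proof (rule power_mono)
    have s1: "1 \<le> sqrt (real (Suc m))" by simp
    have "real (nat (2 * L + 1)) = 2 * real_of_int L + 1"
      using L0 by simp
    also have "\<dots> \<le> 2 * sqrt (2 * real (Suc m)) + 1"
      by (simp add: L_def)
    also have "sqrt (2 * real (Suc m)) = sqrt 2 * sqrt (real (Suc m))"
      by (rule real_sqrt_mult)
    also have "2 * (sqrt 2 * sqrt (real (Suc m))) + 1 \<le> 2 * (3/2 * sqrt (real (Suc m))) + 1 * sqrt (real (Suc m))"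
    proof (intro add_mono mult_left_mono mult_right_mono)
      show "sqrt 2 \<le> 3 / 2" by (rule real_le_lsqrt) (auto simp: power2_eq_square)
    qed (use s1 in auto)
    finally show "real (nat (2 * L + 1)) \<le> 4 * sqrt (real (Suc m))" by simp
  qed simp
  finally show "real (card ?B) \<le> (4 * sqrt (real (Suc m))) ^ CARD('d)" .
qed

lemma set_srw_step: "set_pmf (srw_step :: (int ^ 'd) pmf) = unit_steps"
  unfolding srw_step_def by (subst set_pmf_of_set) auto

lemma map_uminus_srw_step: "map_pmf uminus (srw_step :: (int ^ 'd) pmf) = srw_step"
proof -
  have neg: "- axis i x = axis i (- x)" for i :: 'd and x :: int
    by (auto simp: axis_def vec_eq_iff)
  have "uminus ` (unit_steps :: (int ^ 'd) set) = unit_steps"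
    by (simp add: image_Un image_image neg Un_commute)
  then show ?thesis
    unfolding srw_step_def by (subst map_pmf_of_set_inj) auto
qed

lemma expectation_sq_length_srw_step: "measure_pmf.expectation (srw_step :: (int ^ 'd) pmf) sq_length = 1"
proof -
  have "sq_length v = 1" if v: "v \<in> unit_steps" for v :: "int ^ 'd"
  proof -
    have "sq_length v = (\<Sum>j\<in>{step_axis v}. real_of_int (v $ j) ^ 2)"
      unfolding sq_length_def using unit_step_nth(2)[OF v] by (intro sum.mono_neutral_right) auto
    then show ?thesis using unit_step_nth(1)[OF v] by auto
  qed
  then have "measure_pmf.expectation (srw_step :: (int ^ 'd) pmf) sq_length =
      measure_pmf.expectation (srw_step :: (int ^ 'd) pmf) (\<lambda>_. 1)"
    by (intro integral_cong_AE AE_pmfI) (auto simp: set_srw_step)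
  then show ?thesis by simp
qed

text \<open>
  The mean squared length after \<open>m\<close> steps is \<open>m\<close>. By Markov's inequality at least half of the mass
  has squared length below \<open>2 * (m + 1)\<close>, and there are at most \<open>(4 * sqrt (m + 1)) ^ d\<close> such points.
\<close>
lemma srw_return_lower:
  "real (Suc m) powr - (real CARD('d) / 2) / 4 ^ Suc CARD('d) \<le>
    pmf (sum_pmf (2 * m) (srw_step :: (int ^ 'd) pmf)) 0"
proof -
  let ?q = "sum_pmf m (srw_step :: (int ^ 'd) pmf)" and ?d = "CARD('d)"
  let ?B = "{v :: int ^ 'd. sq_length v < 2 * real (Suc m)}"
  let ?M = "(4 * sqrt (real (Suc m))) ^ ?d"
  have fin: "finite (set_pmf (srw_step :: (int ^ 'd) pmf))"
    by (simp add: set_srw_step)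
  have "measure_pmf.prob ?q {v. 2 * real (Suc m) \<le> sq_length v} \<le>
      measure_pmf.expectation ?q sq_length / (2 * real (Suc m))"
    using integral_Markov_inequality_measure[of "measure_pmf ?q" sq_length UNIV "2 * real (Suc m)"]
    by (simp add: integrable_measure_pmf_finite finite_set_sum_pmf fin sq_length_nonneg)
  also have "\<dots> = real m / (2 * real (Suc m))"
    by (simp only: expectation_sq_length_sum_pmf[OF fin map_uminus_srw_step] expectation_sq_length_srw_step mult_1_right)
  also have "\<dots> \<le> 1 / 2"
    by (simp add: field_simps)
  finally have "measure_pmf.prob ?q (- ?B) \<le> 1 / 2"
    by (simp add: Compl_eq not_less)
  then have "1 / 2 \<le> measure_pmf.prob ?q ?B"
    using measure_pmf.prob_compl[of ?B ?q] by (simp add: Compl_eq_Diff_UNIV)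
  then have "(1 / 2)\<^sup>2 \<le> (measure_pmf.prob ?q ?B)\<^sup>2"
    by (intro power_mono) auto
  also have "\<dots> \<le> real (card ?B) * measure_pmf.expectation ?q (pmf ?q)"
    by (rule prob_square_le_card_mult_expectation[OF card_sq_length_less_le(1)])
  also have "\<dots> \<le> ?M * measure_pmf.expectation ?q (pmf ?q)"
    by (intro mult_right_mono card_sq_length_less_le(2) integral_nonneg_AE) auto
  also have "measure_pmf.expectation ?q (pmf ?q) = pmf (sum_pmf (2 * m) (srw_step :: (int ^ 'd) pmf)) 0"
    using sum_pmf_double_return[OF map_uminus_srw_step[where 'd = 'd], of m] by (simp add: mult_2)
  finally have "1 / 4 / ?M \<le> pmf (sum_pmf (2 * m) (srw_step :: (int ^ 'd) pmf)) 0"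
    by (simp add: power2_eq_square divide_le_eq mult.commute)
  moreover have "1 / 4 / ?M = real (Suc m) powr - (real ?d / 2) / 4 ^ Suc ?d"
  proof -
    have "sqrt (real (Suc m)) ^ ?d = real (Suc m) powr (real ?d / 2)"
      by (simp add: powr_half_sqrt[symmetric] powr_realpow[symmetric] powr_powr)
    then show ?thesis
      by (simp add: power_mult_distrib powr_minus_divide)
  qed
  ultimately show ?thesis by simp
qed

section \<open>Bernstein functions and the subordinator\<close>

locale normalized_bernstein =
  fixes \<phi> :: "real \<Rightarrow> real" and \<mu> :: "real measure"
  assumes bernstein: "complete_bernstein_no_drift \<phi> \<mu>" and one: "\<phi> 1 = 1"
begin

text \<open>
  The integrand of the Levy-Khintchine representation, set to zero on the negative half-line so
  that plain integrals over the real line can be used.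
\<close>
definition bern_fun :: "real \<Rightarrow> real \<Rightarrow> real" where
  "bern_fun s t = indicator {0<..} t * (1 - exp (- s * t))"

lemma levy: "cm_levy_measure \<mu>"
  using bernstein by (simp add: complete_bernstein_no_drift_def)

lemmas sets_levy [measurable_cong] = cm_levy_measure_sets(1)[OF levy]

lemma bern_fun_measurable [measurable]: "bern_fun s \<in> borel_measurable \<mu>"
  unfolding bern_fun_def by measurable

lemma bern_fun_nonneg: "0 \<le> s \<Longrightarrow> 0 \<le> bern_fun s t"
  by (auto simp: bern_fun_def indicator_def)

lemma bern_fun_pos: "0 < s \<Longrightarrow> 0 < t \<Longrightarrow> 0 < bern_fun s t"
  by (auto simp: bern_fun_def)

lemma integrable_bern_fun:
  assumes "0 \<le> s"
  shows "integrable \<mu> (bern_fun s)"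
proof (rule integrableI_bounded)
  have le: "ennreal (norm (bern_fun s t)) \<le> ennreal (1 + s) * (ennreal (min 1 t) * indicator {0<..} t)" for t
  proof (cases "t > 0")
    case True
    have "1 - exp (- s * t) \<le> s * t"
      using exp_ge_add_one_self[of "- s * t"] by simp
    moreover have "s * t \<le> (1 + s) * t"
      using True by (intro mult_right_mono) auto
    moreover have "1 - exp (- s * t) \<le> 1 + s"
      using assms exp_ge_zero[of "- s * t"] by linarith
    ultimately have "1 - exp (- s * t) \<le> (1 + s) * min 1 t"
      by (simp add: min_def)
    then show ?thesis
      using True assms bern_fun_nonneg[of s t]
      by (simp add: bern_fun_def ennreal_mult[symmetric] ennreal_leI del: ennreal_plus)
  qed (simp add: bern_fun_def)
  have "(\<integral>\<^sup>+t. ennreal (norm (bern_fun s t)) \<partial>\<mu>) \<le>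
      (\<integral>\<^sup>+t. ennreal (1 + s) * (ennreal (min 1 t) * indicator {0<..} t) \<partial>\<mu>)"
    by (rule nn_integral_mono) (rule le)
  also have "\<dots> = ennreal (1 + s) * (\<integral>\<^sup>+t\<in>{0<..}. ennreal (min 1 t) \<partial>\<mu>)"
    by (rule nn_integral_cmult) measurable
  also have "\<dots> < \<infinity>"
    using levy by (simp add: cm_levy_measure_def ennreal_mult_less_top)
  finally show "(\<integral>\<^sup>+t. ennreal (norm (bern_fun s t)) \<partial>\<mu>) < \<infinity>" .
qed measurable

lemma phi_eq: "0 \<le> s \<Longrightarrow> \<phi> s = integral\<^sup>L \<mu> (bern_fun s)"
  using bernstein
  by (simp add: complete_bernstein_no_drift_def set_lebesgue_integral_def bern_fun_def[abs_def])

text \<open>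
  The Levy measure does not vanish because \<open>\<phi> 1 = 1\<close>, and it is concentrated on the positive
  half-line. This is the source of all strict inequalities for \<open>\<phi>\<close>.
\<close>
lemma integral_levy_pos:
  fixes f :: "real \<Rightarrow> real"
  assumes "integrable \<mu> f" "\<And>t. 0 \<le> f t" "\<And>t. 0 < t \<Longrightarrow> 0 < f t"
  shows "0 < integral\<^sup>L \<mu> f"
proof (rule ccontr)
  assume "\<not> 0 < integral\<^sup>L \<mu> f"
  moreover have "0 \<le> integral\<^sup>L \<mu> f"
    by (rule Bochner_Integration.integral_nonneg) (rule assms)
  ultimately have "integral\<^sup>L \<mu> f = 0" by simp
  then have "AE t in \<mu>. f t = 0"
    using assms by (subst (asm) integral_nonneg_eq_0_iff_AE) auto
  then have "AE t in \<mu>. bern_fun 1 t = 0"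
  proof eventually_elim
    case (elim t)
    then have "\<not> 0 < t" using assms(3)[of t] by auto
    then show ?case by (simp add: bern_fun_def)
  qed
  then have "integral\<^sup>L \<mu> (bern_fun 1) = 0"
    by (rule integral_eq_zero_AE)
  then show False
    using one by (simp add: phi_eq)
qed

text \<open>
  The increment of the integrand is \<open>exp (- s * t) * (1 - exp (- h * t))\<close>, which is positive and at
  most \<open>1 - exp (- h * t)\<close>. Thus \<open>\<phi>\<close> is strictly increasing and subadditive.
\<close>
lemma phi_increment:
  assumes "0 \<le> s" "0 < h"
  shows "0 < \<phi> (s + h) - \<phi> s" "\<phi> (s + h) - \<phi> s \<le> \<phi> h"
proof -
  have eq: "bern_fun (s + h) t - bern_fun s t = exp (- s * t) * bern_fun h t" for t
  proof -
    have "exp (- (s + h) * t) = exp (- s * t) * exp (- h * t)"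
      by (simp add: exp_add[symmetric] algebra_simps)
    then show ?thesis
      by (simp add: bern_fun_def indicator_def algebra_simps)
  qed
  have diff: "\<phi> (s + h) - \<phi> s = integral\<^sup>L \<mu> (\<lambda>t. bern_fun (s + h) t - bern_fun s t)"
    using assms by (simp add: phi_eq integrable_bern_fun)
  have int: "integrable \<mu> (\<lambda>t. bern_fun (s + h) t - bern_fun s t)"
    using assms by (intro Bochner_Integration.integrable_diff integrable_bern_fun) auto
  show "0 < \<phi> (s + h) - \<phi> s"
    unfolding diff
  proof (rule integral_levy_pos[OF int])
    show "0 \<le> bern_fun (s + h) t - bern_fun s t" for t
      unfolding eq using bern_fun_nonneg[of h t] assms by simp
    show "0 < bern_fun (s + h) t - bern_fun s t" if "0 < t" for t
      unfolding eq using bern_fun_pos[of h t] assms that by simp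
  qed
  have "bern_fun (s + h) t - bern_fun s t \<le> bern_fun h t" for t
  proof (cases "0 < t")
    case True
    then have "exp (- s * t) * bern_fun h t \<le> 1 * bern_fun h t"
      using assms bern_fun_nonneg[of h t] by (intro mult_right_mono) auto
    then show ?thesis by (simp add: eq)
  qed (simp add: bern_fun_def)
  then show "\<phi> (s + h) - \<phi> s \<le> \<phi> h"
    unfolding diff using assms by (subst phi_eq[of h]) (auto intro!: integral_mono int integrable_bern_fun)
qed

lemma phi_less: "0 \<le> s \<Longrightarrow> s < s' \<Longrightarrow> \<phi> s < \<phi> s'"
  using phi_increment(1)[of s "s' - s"] by simp

lemma phi_mono: "0 \<le> s \<Longrightarrow> s \<le> s' \<Longrightarrow> \<phi> s \<le> \<phi> s'"
  using phi_less[of s s'] by (cases "s = s'") auto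

lemma phi_zero: "\<phi> 0 = 0"
  by (simp add: phi_eq bern_fun_def[abs_def])

lemma phi_pos: "0 < s \<Longrightarrow> 0 < \<phi> s"
  using phi_less[of 0 s] by (simp add: phi_zero)

lemma phi_double_le: "0 < s \<Longrightarrow> \<phi> (2 * s) \<le> 2 * \<phi> s"
  using phi_increment(2)[of s s] by simp

text \<open>
  The gap \<open>2 * \<phi> 1 - \<phi> 2\<close> is the integral of \<open>(1 - exp (- t))\<^sup>2\<close>. Probabilistically, the step of the
  subordinator is even with positive probability.
\<close>
lemma phi_two_less: "\<phi> 2 < 2"
proof -
  have eq: "2 * bern_fun 1 t - bern_fun 2 t = (bern_fun 1 t)\<^sup>2" for t
  proof -
    have "exp (- 2 * t) = exp (- t) * exp (- t)"
      by (simp add: exp_add[symmetric])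
    then show ?thesis
      by (simp add: bern_fun_def indicator_def power2_eq_square algebra_simps)
  qed
  have int: "integrable \<mu> (\<lambda>t. 2 * bern_fun 1 t - bern_fun 2 t)"
    by (intro Bochner_Integration.integrable_diff integrable_mult_right integrable_bern_fun) auto
  have "0 < integral\<^sup>L \<mu> (\<lambda>t. 2 * bern_fun 1 t - bern_fun 2 t)"
  proof (rule integral_levy_pos[OF int])
    show "0 \<le> 2 * bern_fun 1 t - bern_fun 2 t" for t
      unfolding eq by simp
    show "0 < 2 * bern_fun 1 t - bern_fun 2 t" if "0 < t" for t
      unfolding eq using bern_fun_pos[of 1 t] that by simp
  qed
  also have "\<dots> = 2 * \<phi> 1 - \<phi> 2"
    by (simp add: phi_eq integrable_bern_fun)
  finally show ?thesis
    by (simp add: one)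
qed

text \<open>
  Summing the exponential series under the integral gives the integral of
  \<open>exp (- t) * (exp (t * z) - 1) = (1 - exp (- t)) - (1 - exp (- (1 - z) * t))\<close>. The interchange is
  licensed by absolute convergence, as the weights are summable and \<open>\<bar>z\<bar> \<le> 1\<close>.
\<close>
lemma expectation_power_sub_step:
  assumes z: "\<bar>z\<bar> \<le> 1"
  shows "measure_pmf.expectation (sub_step \<mu>) (\<lambda>m. z ^ m) = 1 - \<phi> (1 - z)"
proof -
  let ?a = "pmf (sub_step \<mu>)"
  define h where "h m t = indicator {0<..} t * (if m = 0 then 0 else t ^ m * exp (- t) / fact m)"
    for m :: nat and t :: real
  have hm [measurable]: "h m \<in> borel_measurable \<mu>" for m
    unfolding h_def by measurable
  have h_nonneg: "0 \<le> h m t" for m t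
    by (auto simp: h_def indicator_def)
  have h_sums: "(\<lambda>m. h m t) sums bern_fun 1 t" for t
    using sums_mult[OF sum_exp_weights[of t], of "indicator {0<..} t"] by (simp add: h_def bern_fun_def)
  have h_le: "h m t \<le> bern_fun 1 t" for m t
    using sum_le_suminf[of "\<lambda>m. h m t" "{m}"] h_sums[of t] h_nonneg by (auto simp: sums_iff)
  have h_int: "integrable \<mu> (h m)" for m
    by (rule Bochner_Integration.integrable_bound[OF integrable_bern_fun[of 1]])
       (use h_le h_nonneg in \<open>auto intro!: AE_I2 order_trans[OF h_le abs_ge_self]\<close>)
  have h_integral: "integral\<^sup>L \<mu> (h m) = ?a m" for m
    by (cases "m = 0")
       (simp_all add: pmf_sub_step[OF bernstein one] h_def[abs_def] sub_weight_def
         set_lebesgue_integral_def mult_ac flip: integral_mult_right_zero)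
  have a_summable: "summable ?a"
    using integrable_pmf[of UNIV "sub_step \<mu>"] by (simp add: integrable_count_space_nat_iff)
  have zpow: "\<bar>z ^ m\<bar> \<le> 1" for m
    using z by (simp add: power_abs power_le_one)
  have hz_sums: "(\<lambda>m. h m t * z ^ m) sums (bern_fun 1 t - bern_fun (1 - z) t)" for t
  proof -
    have "(\<lambda>m. if m = 0 then 0 else (t * z) ^ m * exp (- (t * z)) / fact m) sums (1 - exp (- (t * z)))"
      by (rule sum_exp_weights)
    then have "(\<lambda>m. indicator {0<..} t * (exp (- t) * exp (t * z)) *
        (if m = 0 then 0 else (t * z) ^ m * exp (- (t * z)) / fact m)) sums
        (indicator {0<..} t * (exp (- t) * exp (t * z)) * (1 - exp (- (t * z))))"
      by (rule sums_mult)
    moreover have "indicator {0<..} t * (exp (- t) * exp (t * z)) *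
        (if m = 0 then 0 else (t * z) ^ m * exp (- (t * z)) / fact m) = h m t * z ^ m" for m
      by (simp add: h_def power_mult_distrib exp_minus field_simps)
    moreover have "indicator {0<..} t * (exp (- t) * exp (t * z)) * (1 - exp (- (t * z))) =
        bern_fun 1 t - bern_fun (1 - z) t"
      by (simp add: bern_fun_def indicator_def right_diff_distrib left_diff_distrib exp_add[symmetric] exp_minus_inverse)
    ultimately show ?thesis by simp
  qed
  have "(\<lambda>m. integral\<^sup>L \<mu> (\<lambda>t. h m t * z ^ m)) sums integral\<^sup>L \<mu> (\<lambda>t. \<Sum>m. h m t * z ^ m)"
  proof (rule sums_integral)
    show "integrable \<mu> (\<lambda>t. h m t * z ^ m)" for m
      using h_int by simp
    have bd: "norm (h m t * z ^ m) \<le> h m t" for m t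
      using mult_left_mono[OF zpow[of m] h_nonneg[of m t]] h_nonneg[of m t] by (simp add: abs_mult)
    show "AE t in \<mu>. summable (\<lambda>m. norm (h m t * z ^ m))"
      by (rule AE_I2, rule summable_comparison_test'[where N = 0 and g = "\<lambda>m. h m _"])
         (use h_sums bd in \<open>auto simp: sums_iff\<close>)
    show "summable (\<lambda>m. integral\<^sup>L \<mu> (\<lambda>t. norm (h m t * z ^ m)))"
    proof (rule summable_comparison_test'[OF a_summable, of 0])
      fix m :: nat
      have "integral\<^sup>L \<mu> (\<lambda>t. norm (h m t * z ^ m)) \<le> integral\<^sup>L \<mu> (h m)"
        by (intro integral_mono integrable_norm h_int bd) (use h_int in simp)
      then show "norm (integral\<^sup>L \<mu> (\<lambda>t. norm (h m t * z ^ m))) \<le> ?a m"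
        by (simp add: h_integral)
    qed
  qed
  moreover have "(\<Sum>m. h m t * z ^ m) = bern_fun 1 t - bern_fun (1 - z) t" for t
    using hz_sums[of t] by (simp add: sums_iff)
  moreover have "integral\<^sup>L \<mu> (\<lambda>t. bern_fun 1 t - bern_fun (1 - z) t) = 1 - \<phi> (1 - z)"
    using z one by (simp add: integrable_bern_fun phi_eq)
  ultimately have sums: "(\<lambda>m. ?a m * z ^ m) sums (1 - \<phi> (1 - z))"
    by (simp add: h_integral)
  have "measure_pmf.expectation (sub_step \<mu>) (\<lambda>m. z ^ m) =
      integral\<^sup>L (count_space UNIV) (\<lambda>m. ?a m * z ^ m)"
    by (simp add: measure_pmf_eq_density integral_density)
  also have "\<dots> = (\<Sum>m. ?a m * z ^ m)"
  proof (rule integral_count_space_nat)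
    have "summable (\<lambda>m. norm (?a m * z ^ m))"
      by (rule summable_comparison_test'[OF a_summable, of 0])
         (use mult_left_mono[OF zpow pmf_nonneg] in \<open>simp add: abs_mult\<close>)
    then show "integrable (count_space UNIV) (\<lambda>m. ?a m * z ^ m)"
      by (simp add: integrable_count_space_nat_iff)
  qed
  finally show ?thesis
    using sums by (simp add: sums_iff)
qed

lemma expectation_power_subordinator:
  assumes "\<bar>z\<bar> \<le> 1"
  shows "measure_pmf.expectation (sum_pmf n (sub_step \<mu>)) (\<lambda>m. z ^ m) = (1 - \<phi> (1 - z)) ^ n"
  by (simp add: expectation_power_sum_pmf expectation_power_sub_step assms)

text \<open>
  Subadditivity upgrades the power bound near the origin to Hoelder continuity on \<open>(0,1]\<close>, so the
  intermediate value theorem applies; the bound itself also provides arguments with small values.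
\<close>
lemma phi_inverse:
  assumes c: "0 < c" and \<alpha>: "0 < \<alpha>"
    and small: "\<And>r. 0 < r \<Longrightarrow> r \<le> 1 \<Longrightarrow> \<phi> r \<le> c * r powr \<alpha>"
    and y: "0 < y" "y \<le> 1"
  obtains r where "0 < r" "r \<le> 1" "\<phi> r = y" "bernstein_inv \<phi> y = r"
proof -
  \<comment> \<open>At \<open>e\<close> the power bound is at most \<open>y\<close>, which gives the left end of the interval.\<close>
  define e where "e = min 1 ((y / c) powr (1 / \<alpha>))"
  have e: "0 < e" "e \<le> 1"
    using y c by (auto simp: e_def)
  have "\<phi> e \<le> c * e powr \<alpha>"
    using e by (rule small)
  also have "\<dots> \<le> c * ((y / c) powr (1 / \<alpha>)) powr \<alpha>"
    using e c \<alpha> by (intro mult_left_mono powr_mono2) (auto simp: e_def)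
  also have "\<dots> = y"
    using y c \<alpha> by (simp add: powr_powr)
  finally have "\<phi> e \<le> y" .
  have holder: "\<bar>\<phi> a - \<phi> b\<bar> \<le> c * \<bar>a - b\<bar> powr \<alpha>" if "a \<in> {e..1}" "b \<in> {e..1}" for a b
  proof -
    have *: "\<bar>\<phi> a - \<phi> b\<bar> \<le> c * \<bar>a - b\<bar> powr \<alpha>" if "e \<le> b" "b < a" "a \<le> 1" for a b
    proof -
      have "\<bar>\<phi> a - \<phi> b\<bar> \<le> \<phi> (a - b)"
        using phi_increment[of b "a - b"] that e by simp
      also have "\<dots> \<le> c * (a - b) powr \<alpha>"
        using that e by (intro small) auto
      finally show ?thesis using that by simp
    qed
    consider "a = b" | "a < b" | "b < a" by linarith
    then show ?thesis
      using that *[of a b] *[of b a] by cases (auto simp: abs_minus_commute)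
  qed
  have "continuous_on {e..1} \<phi>"
    unfolding continuous_on_def
  proof
    fix b assume b: "b \<in> {e..1}"
    have "((\<lambda>a. \<phi> a - \<phi> b) \<longlongrightarrow> 0) (at b within {e..1})"
    proof (rule Lim_null_comparison)
      show "\<forall>\<^sub>F a in at b within {e..1}. norm (\<phi> a - \<phi> b) \<le> c * \<bar>a - b\<bar> powr \<alpha>"
        using holder b by (auto simp: eventually_at_filter)
      have "((\<lambda>a. \<bar>a - b\<bar>) \<longlongrightarrow> \<bar>b - b\<bar>) (at b within {e..1})"
        by (intro tendsto_intros)
      then have "((\<lambda>a. \<bar>a - b\<bar> powr \<alpha>) \<longlongrightarrow> 0 powr \<alpha>) (at b within {e..1})"
        using \<alpha> by (intro tendsto_powr') auto
      then show "((\<lambda>a. c * \<bar>a - b\<bar> powr \<alpha>) \<longlongrightarrow> 0) (at b within {e..1})"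
        using tendsto_mult_right_zero by force
    qed
    then show "(\<phi> \<longlongrightarrow> \<phi> b) (at b within {e..1})"
      by (simp add: LIM_zero_iff)
  qed
  then obtain r where r: "e \<le> r" "r \<le> 1" "\<phi> r = y"
    using IVT'[of \<phi> e y 1] \<open>\<phi> e \<le> y\<close> y e one by auto
  have inj: "inj_on \<phi> {0<..}"
    by (rule linorder_inj_onI') (auto dest: phi_less[OF less_imp_le])
  have "bernstein_inv \<phi> y = r"
    unfolding bernstein_inv_def using r e by (intro the_inv_into_f_eq[OF inj]) auto
  with r e that show ?thesis by auto
qed

context
  fixes c \<alpha> :: real
  assumes c: "0 < c" and \<alpha>: "0 < \<alpha>"
    and lower: "\<And>r R. 0 < r \<Longrightarrow> r \<le> R \<Longrightarrow> R \<le> 1 \<Longrightarrow> c * (R / r) powr \<alpha> \<le> \<phi> R / \<phi> r"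
begin

lemma phi_inverse_of_nat:
  assumes "1 \<le> n"
  obtains r where "0 < r" "r \<le> 1" "\<phi> r = 1 / real n" "bernstein_inv \<phi> (1 / real n) = r"
proof (rule phi_inverse[of "1 / c" \<alpha> "1 / real n"])
  show "\<phi> r \<le> 1 / c * r powr \<alpha>" if "0 < r" "r \<le> 1" for r
  proof -
    have "c * (1 / r) powr \<alpha> \<le> 1 / \<phi> r"
      using lower[of r 1] that one by simp
    then show ?thesis
      using that c phi_pos[of r] by (simp add: powr_divide field_simps)
  qed
qed (use c \<alpha> assms that in auto)

text \<open>
  The Laplace transform at \<open>s \<ge> r\<close> is at most \<open>exp (- n * \<phi> (1 - exp (- s)))\<close>. As \<open>1 - exp (- s)\<close> is
  at least \<open>s / 2\<close> and \<open>\<phi>\<close> is subadditive, the exponent is at least \<open>n * \<phi> s / 2\<close>, which the scaling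
  inequality compares with \<open>n * \<phi> r = 1\<close>.
\<close>
lemma subordinator_negative_moment:
  assumes \<beta>: "0 < \<beta>"
  shows "\<exists>C>0. \<forall>n\<ge>1. measure_pmf.expectation (sum_pmf n (sub_step \<mu>)) (\<lambda>k. real (Suc k) powr - \<beta>) \<le>
    C * bernstein_inv \<phi> (1 / real n) powr \<beta>"
proof -
  obtain C0 where C0: "C0 > 0" "\<And>x. x > 0 \<Longrightarrow> exp (- (c / 2 * x powr \<alpha>)) \<le> C0 * x powr - (2 * \<beta>)"
    using exp_neg_powr_le[of "c / 2" \<alpha> "2 * \<beta>"] c \<alpha> \<beta> by auto
  define C1 where "C1 = 1 + C0 * exp 1 * 2 powr \<beta> / (1 - 2 powr - \<beta>)"
  have "2 powr - \<beta> < (1::real)"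
    using \<beta> powr_less_mono[of "- \<beta>" 0 "2::real"] by simp
  then have C1: "C1 > 0"
    using C0 unfolding C1_def by (intro add_pos_nonneg) auto
  have "measure_pmf.expectation (sum_pmf n (sub_step \<mu>)) (\<lambda>k. real (Suc k) powr - \<beta>) \<le>
      C1 * bernstein_inv \<phi> (1 / real n) powr \<beta>" if n: "1 \<le> n" for n
  proof -
    obtain r where r: "0 < r" "r \<le> 1" "\<phi> r = 1 / real n" "bernstein_inv \<phi> (1 / real n) = r"
      using phi_inverse_of_nat[OF n] .
    show ?thesis
      unfolding r(4) C1_def
    proof (rule negative_moment_le[OF \<beta> r(1)])
      fix s assume s: "r \<le> s" "s \<le> 1"
      have s0: "0 < s" using s r by simp
      let ?x = "1 - exp (- s)"
      have x: "0 < ?x" "?x \<le> 1" using s0 by auto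
      have "c * (s / r) powr \<alpha> / real n \<le> \<phi> s"
        using lower[of r s] r s n by (simp add: field_simps)
      also have "\<phi> s \<le> 2 * \<phi> (s / 2)"
        using phi_double_le[of "s / 2"] s0 by simp
      also have "\<phi> (s / 2) \<le> \<phi> ?x"
        using one_minus_exp_ge_half[of s] s s0 by (intro phi_mono) auto
      finally have *: "c / 2 * (s / r) powr \<alpha> \<le> real n * \<phi> ?x"
        using n by (simp add: field_simps)
      have "measure_pmf.expectation (sum_pmf n (sub_step \<mu>)) (\<lambda>k. exp (- s) ^ k) = (1 - \<phi> ?x) ^ n"
        using s0 by (intro expectation_power_subordinator) simp
      also have "\<dots> \<le> exp (- \<phi> ?x) ^ n"
        using exp_ge_add_one_self[of "- \<phi> ?x"] phi_mono[of ?x 1] x one by (intro power_mono) auto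
      also have "\<dots> = exp (- (real n * \<phi> ?x))"
        by (simp add: exp_of_nat_mult[symmetric])
      also have "\<dots> \<le> exp (- (c / 2 * (s / r) powr \<alpha>))"
        using * by simp
      also have "\<dots> \<le> C0 * (s / r) powr - (2 * \<beta>)"
        using s0 r by (intro C0) simp
      finally show "measure_pmf.expectation (sum_pmf n (sub_step \<mu>)) (\<lambda>k. exp (- s) ^ k) \<le>
          C0 * (s / r) powr - (2 * \<beta>)" .
    qed (use C0 in simp)
  qed
  with C1 show ?thesis by blast
qed

text \<open>
  In the integrand, \<open>(1 + (- 1) ^ k) / 2\<close> is the indicator of the even numbers, while
  \<open>2 * (1 - exp (- s) ^ k)\<close> is an upper bound for the indicator of \<open>s * k \<ge> 1\<close>. The first term has
  expectation bounded below because \<open>\<bar>1 - \<phi> 2\<bar> < 1\<close>; the second is at most \<open>2 * n * \<phi> (r / K)\<close>, which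
  the scaling inequality makes small for large \<open>K\<close>.
\<close>
lemma expectation_even_minus_tail_ge:
  shows "\<exists>K\<ge>1. \<exists>\<eta>>0. \<forall>n\<ge>1. \<eta> \<le> measure_pmf.expectation (sum_pmf n (sub_step \<mu>))
    (\<lambda>k. (1 + (- 1) ^ k) / 2 - 2 * (1 - exp (- (bernstein_inv \<phi> (1 / real n) / K)) ^ k))"
proof -
  define \<eta> where "\<eta> = (1 - (\<phi> 2 - 1)) / 4"
  have \<eta>: "\<eta> > 0" using phi_two_less by (simp add: \<eta>_def)
  have phi2: "1 \<le> \<phi> 2" using phi_mono[of 1 2] one by simp
  \<comment> \<open>Chosen so that \<open>2 / (c * K powr \<alpha>) \<le> \<eta>\<close>.\<close>
  define K where "K = max 1 ((2 / (c * \<eta>)) powr (1 / \<alpha>))"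
  have K: "1 \<le> K" by (simp add: K_def)
  have "2 / (c * \<eta>) = ((2 / (c * \<eta>)) powr (1 / \<alpha>)) powr \<alpha>"
    using c \<eta> \<alpha> by (simp add: powr_powr)
  also have "\<dots> \<le> K powr \<alpha>"
    using \<alpha> by (intro powr_mono2) (auto simp: K_def)
  finally have K\<alpha>: "2 / (c * \<eta>) \<le> K powr \<alpha>" .
  have "\<eta> \<le> measure_pmf.expectation (sum_pmf n (sub_step \<mu>))
    (\<lambda>k. (1 + (- 1) ^ k) / 2 - 2 * (1 - exp (- (bernstein_inv \<phi> (1 / real n) / K)) ^ k))" if n: "1 \<le> n" for n
  proof -
    obtain r where r: "0 < r" "r \<le> 1" "\<phi> r = 1 / real n" "bernstein_inv \<phi> (1 / real n) = r"
      using phi_inverse_of_nat[OF n] .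
    define s where "s = r / K"
    have s: "0 < s" "s \<le> r" "s \<le> 1"
      using r K by (auto simp: s_def divide_le_eq mult_le_cancel_left1 intro: order_trans[of _ r])
    let ?x = "1 - exp (- s)"
    let ?E = "measure_pmf.expectation (sum_pmf n (sub_step \<mu>))"
    have x: "0 < ?x" "?x \<le> s" "?x \<le> 1"
      using s exp_ge_add_one_self[of "- s"] by auto
    have int: "integrable (measure_pmf p) (\<lambda>k::nat. z ^ k)" if "\<bar>z\<bar> \<le> 1" for z :: real and p
      using that by (intro measure_pmf.integrable_const_bound[where B = 1]) (auto simp: power_abs power_le_one)
    have E: "?E (\<lambda>k. (1 + (- 1) ^ k) / 2 - 2 * (1 - exp (- s) ^ k)) =
        (1 + (1 - \<phi> 2) ^ n) / 2 - 2 * (1 - (1 - \<phi> ?x) ^ n)"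
      using expectation_power_subordinator[of "- 1" n] expectation_power_subordinator[of "exp (- s)" n] s
      by (simp add: int)
    have "\<bar>(1 - \<phi> 2) ^ n\<bar> = (\<phi> 2 - 1) ^ n"
      using phi2 by (simp add: power_abs)
    also have "\<dots> \<le> (\<phi> 2 - 1) ^ 1"
      using phi2 phi_two_less n by (intro power_decreasing) auto
    finally have even: "2 * \<eta> \<le> (1 + (1 - \<phi> 2) ^ n) / 2"
      by (simp add: \<eta>_def)
    have "1 + real n * (- \<phi> ?x) \<le> (1 + (- \<phi> ?x)) ^ n"
      using phi_mono[of ?x 1] x one by (intro Bernoulli_inequality) auto
    then have "1 - (1 - \<phi> ?x) ^ n \<le> real n * \<phi> ?x"
      by simp
    also have "\<dots> \<le> real n * \<phi> s"
      using x by (intro mult_left_mono phi_mono) auto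
    also have "\<dots> \<le> 1 / (c * K powr \<alpha>)"
    proof -
      have "c * (r / s) powr \<alpha> \<le> \<phi> r / \<phi> s"
        using s r by (intro lower) auto
      moreover have "r / s = K"
        using r K by (simp add: s_def)
      ultimately have "c * K powr \<alpha> * (real n * \<phi> s) \<le> 1"
        using phi_pos[OF s(1)] n r(3) by (simp add: field_simps)
      then show ?thesis
        using c K by (simp add: field_simps)
    qed
    also have "\<dots> \<le> \<eta> / 2"
      using K\<alpha> c \<eta> K by (simp add: field_simps)
    finally have "2 * (1 - (1 - \<phi> ?x) ^ n) \<le> \<eta>" by simp
    with even show ?thesis
      unfolding r(4) s_def[symmetric] E by linarith
  qed
  with K \<eta> show ?thesis by blast
qed

end

end

section \<open>Return probabilities of the subordinate walk\<close>

theorem theorem3p1: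
  fixes \<phi> :: "real \<Rightarrow> real" and \<mu> :: "real measure"
  assumes "complete_bernstein_no_drift \<phi> \<mu>"
    and "\<phi> 0 = 0" and "\<phi> 1 = 1"
    and "scaling_condition \<phi>"
  shows "\<exists>c1 c2 :: real. c1 > 0 \<and> c2 > 0 \<and>
    (\<forall>n :: nat. n \<ge> 1 \<longrightarrow> (\<forall>x :: int ^ 'd.
      c1 * bernstein_inv \<phi> (1 / real n) powr (real CARD('d) / 2) \<le> sub_trans_prob \<mu> n x x \<and>
      sub_trans_prob \<mu> n x x \<le> c2 * bernstein_inv \<phi> (1 / real n) powr (real CARD('d) / 2)))"
proof -
  interpret normalized_bernstein \<phi> \<mu>
    by unfold_locales (fact assms)+
  obtain c \<alpha> where c: "0 < c" and \<alpha>: "0 < \<alpha>"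
    and lower: "\<And>r R. 0 < r \<Longrightarrow> r \<le> R \<Longrightarrow> R \<le> 1 \<Longrightarrow> c * (R / r) powr \<alpha> \<le> \<phi> R / \<phi> r"
    using assms(4) unfolding scaling_condition_def by blast
  define \<beta> where "\<beta> = real CARD('d) / 2"
  have \<beta>: "0 < \<beta>" by (simp add: \<beta>_def)
  let ?p = "\<lambda>k. pmf (sum_pmf k (srw_step :: (int ^ 'd) pmf)) 0"
  let ?E = "\<lambda>n. measure_pmf.expectation (sum_pmf n (sub_step \<mu>))"
  let ?r = "\<lambda>n::nat. bernstein_inv \<phi> (1 / real n)"
  obtain C where C: "C > 0" "\<And>k. ?p k \<le> C * real (Suc k) powr - \<beta>"
    using srw_return_upper[where 'd = 'd] unfolding \<beta>_def by blast
  obtain C' where C': "C' > 0" "\<And>n. 1 \<le> n \<Longrightarrow> ?E n (\<lambda>k. real (Suc k) powr - \<beta>) \<le> C' * ?r n powr \<beta>"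
    using subordinator_negative_moment[OF c \<alpha> lower \<beta>] by blast
  obtain K \<eta> where K: "1 \<le> K" and \<eta>: "0 < \<eta>" and good: "\<And>n. 1 \<le> n \<Longrightarrow>
      \<eta> \<le> ?E n (\<lambda>k. (1 + (- 1) ^ k) / 2 - 2 * (1 - exp (- (?r n / K)) ^ k))"
    using expectation_even_minus_tail_ge[OF c \<alpha> lower] by blast
  define c1 where "c1 = (1 / (2 * K)) powr \<beta> / 4 ^ Suc CARD('d)"
  have c1: "0 < c1" using K by (simp add: c1_def)
  have int_p: "integrable (measure_pmf q) ?p" for q
    by (intro measure_pmf.integrable_const_bound[where B = 1]) (auto simp: pmf_le_1)
  have upper_bound: "?E n ?p \<le> C * C' * ?r n powr \<beta>" if n: "1 \<le> n" for n
  proof -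
    have "?E n ?p \<le> ?E n (\<lambda>k. C * real (Suc k) powr - \<beta>)"
    proof (intro integral_mono int_p C integrable_mult_right measure_pmf.integrable_const_bound[where B = 1] AE_pmfI)
      fix k
      have "real (Suc k) powr - \<beta> \<le> 1 powr - \<beta>"
        using \<beta> by (intro powr_mono2') auto
      then show "norm (real (Suc k) powr - \<beta>) \<le> 1" by simp
    qed simp
    also have "\<dots> \<le> C * (C' * ?r n powr \<beta>)"
      using C C'(2)[OF n] by simp
    finally show ?thesis by (simp only: mult.assoc)
  qed
  have lower_bound: "\<eta> * c1 * ?r n powr \<beta> \<le> ?E n ?p" if n: "1 \<le> n" for n
  proof -
    obtain r where r: "0 < r" "r \<le> 1" "?r n = r"
      using phi_inverse_of_nat[OF c \<alpha> lower n] by blast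
    define s where "s = r / K"
    have s: "0 < s" "s \<le> 1"
      using r K by (auto simp: s_def divide_le_eq)
    define A where "A = c1 * r powr \<beta>"
    have A: "0 \<le> A" using c1 by (simp add: A_def)
    let ?g = "\<lambda>k::nat. (1 + (- 1) ^ k) / 2 - 2 * (1 - exp (- s) ^ k)"
    have pow1: "exp (- s) ^ k \<le> 1" for k :: nat
      using s by (intro power_le_one) auto
    \<comment> \<open>If \<open>k\<close> is odd or \<open>s * k \<ge> 1\<close>, then \<open>?g k \<le> 0\<close>; otherwise \<open>k\<close> is even and at most \<open>K / r\<close>.\<close>
    have pointwise: "A * ?g k \<le> ?p k" for k
    proof (cases "even k \<and> s * real k < 1")
      case True
      then obtain m where m: "k = 2 * m" by (auto elim: evenE)
      have "real (Suc m) \<le> 2 * K / r"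
      proof -
        have "real (Suc m) \<le> 1 + real k" by (simp add: m)
        also have "\<dots> \<le> 1 / s + 1 / s"
          using True s by (intro add_mono) (auto simp: field_simps)
        finally show ?thesis by (simp add: s_def)
      qed
      then have "(2 * K / r) powr - \<beta> \<le> real (Suc m) powr - \<beta>"
        using \<beta> by (intro powr_mono2') auto
      moreover have "(2 * K / r) powr - \<beta> = (1 / (2 * K)) powr \<beta> * r powr \<beta>"
        using r K by (simp add: powr_minus powr_divide powr_mult field_simps)
      ultimately have "A \<le> real (Suc m) powr - \<beta> / 4 ^ Suc CARD('d)"
        by (simp add: A_def c1_def divide_right_mono)
      also have "\<dots> \<le> ?p k"
        using srw_return_lower[where 'd = 'd, of m] by (simp add: m \<beta>_def)
      finally have "A \<le> ?p k" .
      moreover have "A * ?g k \<le> A * 1"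
        using A True pow1[of k] by (intro mult_left_mono) auto
      ultimately show ?thesis by simp
    next
      case False
      have "?g k \<le> 0"
      proof (cases "even k")
        case True
        with False have "1 \<le> s * real k" by simp
        then have "exp (- s) ^ k \<le> exp (- 1)"
          by (simp add: exp_of_nat_mult[symmetric] mult.commute)
        also have "\<dots> \<le> 1 / 2"
          using exp_ge_add_one_self[of "1::real"] by (simp add: exp_minus field_simps)
        finally show ?thesis using True by simp
      next
        case False
        then show ?thesis using pow1[of k] by simp
      qed
      then have "A * ?g k \<le> 0" using A by (intro mult_nonneg_nonpos)
      also have "0 \<le> ?p k" by simp
      finally show ?thesis .
    qed
    have "\<eta> * A \<le> A * ?E n ?g"
      using good[OF n] A unfolding r(3) s_def[symmetric] by (simp add: mult.commute mult_left_mono)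
    also have "\<dots> = ?E n (\<lambda>k. A * ?g k)"
      by simp
    also have "\<dots> \<le> ?E n ?p"
    proof (intro integral_mono int_p pointwise integrable_mult_right measure_pmf.integrable_const_bound[where B = 3] AE_pmfI)
      fix k :: nat
      have "\<bar>(1 + (- 1) ^ k) / 2 - 2 * (1 - e)\<bar> \<le> 3" if "0 \<le> e" "e \<le> 1" for e :: real
        using that by (cases "even k") auto
      from this[OF _ pow1[of k]] show "norm (?g k) \<le> 3" by simp
    qed simp
    finally show ?thesis
      by (simp add: A_def r(3) mult.assoc)
  qed
  show ?thesis
    unfolding sub_trans_prob_conv_pmf
    using c1 \<eta> C(1) C'(1) lower_bound upper_bound
    by (intro exI[of _ "\<eta> * c1"] exI[of _ "C * C'"]) (simp add: \<beta>_def)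
qed

end
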